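(* Let $\tau$ be a primitive, aperiodic, segregating substitution whose ll, rl, ls and rs graphs are all subfixed. Then for every left special or right special sequence $x\in X_\tau$ there exists a generator $g$ for $\tau$ such that $g^*\sim_o x$.
   Context: Let $\mathcal{A}$ be a finite nonempty alphabet, $\mathcal{A}^*$ the finite words over $\mathcal{A}$ (including the empty word), $\mathcal{A}^+$ the nonempty words, $|u|$ the length of $u$. A word $u$ is a factor of $v$ if $v=w_1uw_2$ for some words $w_1,w_2$. A substitution is a map $\tau:\mathcal{A}\to\mathcal{A}^+$ extended to a concatenation-respecting map on words and letterwise to sequences. For $x\in\mathcal{A}^{\mathbb{Z}}$, $x_{[i]}$ denotes the letter at index $i$, $x_{[i,j]}$ the word $x_{[i]}\cdots x_{[j]}$, and $x_{[i,\infty[}$ the one-sided sequence $x_{[i]}x_{[i+1]}\cdots$. The language $\mathcal{L}(\tau)$ is the set of words that are factors of $\tau^m(a)$ for some letter $a$ and some $m\ge1$, and $\mathcal{L}_k(\tau)$ denotes its words of length $k$; $X_\tau=\{x\in\mathcal{A}^{\mathbb{Z}}: x_{[i,j]}\in\mathcal{L}(\tau)\ \forall i\le j\}$. $\tau$ is primitive if there is $m\ge1$ such that every letter $b$ is a factor of $\tau^m(a)$ for every letter $a$, and there is a letter $a$ such that for every $N$ there is $m$ with $|\tau^m(a)|>N$; a primitive $\tau$ is aperiodic if $X_\tau$ is infinite. A sequence $x\in X_\tau$ is left special if there is $y\in X_\tau$ with $x_{[-1]}\neq y_{[-1]}$ and $x_{[0,\infty[}=y_{[0,\infty[}$; it is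 right special if there is $y\in X_\tau$ with $x_{[0]}\neq y_{[0]}$ and $x_{[i]}=y_{[i]}$ for all $i\le -1$. For $x,y\in X_\tau$, $x\sim_o y$ means there is $m\in\mathbb{Z}$ with $x_{[i]}=y_{[i+m]}$ for all $i$. A generator for $\tau$ is a triple $(v,u,w)$ with $v,u,w\in\mathcal{A}^+$, $u\in\mathcal{L}(\tau)$ and $\tau(u)=vuw$; its completion $(v,u,w)^*$ is the two-sided sequence $\cdots\tau^2(v)\tau(v)vu.w\tau(w)\tau^2(w)\cdots$, i.e. the left-infinite word $\cdots\tau^2(v)\tau(v)vu$ occupies the negative indices, ending at index $-1$, and the right-infinite word $w\tau(w)\tau^2(w)\cdots$ occupies the indices $\ge0$, starting at index $0$. A positive integer $k$ is a left segregating number for $\tau$ if for any two words $s,t\in\mathcal{L}_k(\tau)$ with different leftmost letters, the length of the longest common prefix of $\tau(s)$ and $\tau(t)$ is at most $\min\{|\tau(s)|,|\tau(t)|\}-k$; right segregating numbers are defined symmetrically using rightmost letters and longest common suffixes. $\tau$ is segregating if it has both a left and a right segregating number. The ll graph (resp. rl graph) is the directed graph on vertex set $\mathcal{A}$ with exactly one edge from each letter $a$ to the leftmost (resp. rightmost) letter of $\tau(a)$. If $n$ is the least left segregating number, the ls graph has as vertices the ordered pairs $(s,t)$ of words in $\mathcal{L}_n(\tau)$ with different leftmost letters, and exactly one edge from $(s,t)$ to $(s',t')$, where $s'$, $t'$ are the first $n$ letters of the words obtained by deleting the longest common prefix from $\tau(s)$ and $\tau(t)$ respectively. If $n$ is the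 least right segregating number, the rs graph has as vertices the ordered pairs $(s,t)$ of words in $\mathcal{L}_n(\tau)$ with different rightmost letters, and exactly one edge from $(s,t)$ to $(s',t')$, where $s'$, $t'$ are the last $n$ letters of the words obtained by deleting the longest common suffix from $\tau(s)$ and $\tau(t)$ respectively. Such a graph (every vertex having exactly one outgoing edge) is subfixed if for every vertex $x$, either the edge leaving $x$ goes to $x$, or it goes to a vertex $y$ whose outgoing edge goes to $y$ itself. *)

theory Defs
  imports Main "HOL-Library.Sublist"
begin

text \<open>Alphabet: a finite type 'a (types are nonempty). Words: 'a list.
 A substitution is tau :: 'a => 'a list with all images nonempty; it is
 extended to words by concatenation. Two-sided sequences: int => 'a.\<close>

definition is_substitution :: "('a \<Rightarrow> 'a list) \<Rightarrow> bool" where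
  "is_substitution \<tau> \<longleftrightarrow> (\<forall>a. \<tau> a \<noteq> [])"

definition substw :: "('a \<Rightarrow> 'a list) \<Rightarrow> 'a list \<Rightarrow> 'a list" where
  "substw \<tau> u = concat (map \<tau> u)"

definition lang :: "('a \<Rightarrow> 'a list) \<Rightarrow> 'a list set" where
  "lang \<tau> = {u. \<exists>a m. m \<ge> 1 \<and> sublist u ((substw \<tau> ^^ m) [a])}"

definition lang_k :: "('a \<Rightarrow> 'a list) \<Rightarrow> nat \<Rightarrow> 'a list set" where
  "lang_k \<tau> k = {u \<in> lang \<tau>. length u = k}"

definition seg :: "(int \<Rightarrow> 'a) \<Rightarrow> int \<Rightarrow> int \<Rightarrow> 'a list" where
  "seg x i j = map x [i..j]"

definition shift_space :: "('a \<Rightarrow> 'a list) \<Rightarrow> (int \<Rightarrow> 'a) set" where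
  "shift_space \<tau> = {x. \<forall>i j. i \<le> j \<longrightarrow> seg x i j \<in> lang \<tau>}"

definition primitive :: "('a \<Rightarrow> 'a list) \<Rightarrow> bool" where
  "primitive \<tau> \<longleftrightarrow>
     (\<exists>m\<ge>1. \<forall>a b. sublist [b] ((substw \<tau> ^^ m) [a])) \<and>
     (\<exists>a. \<forall>N. \<exists>m. length ((substw \<tau> ^^ m) [a]) > N)"

definition aperiodic :: "('a \<Rightarrow> 'a list) \<Rightarrow> bool" where
  "aperiodic \<tau> \<longleftrightarrow> primitive \<tau> \<and> infinite (shift_space \<tau>)"

definition left_special :: "('a \<Rightarrow> 'a list) \<Rightarrow> (int \<Rightarrow> 'a) \<Rightarrow> bool" where
  "left_special \<tau> x \<longleftrightarrow> x \<in> shift_space \<tau> \<and>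
     (\<exists>y \<in> shift_space \<tau>. x (-1) \<noteq> y (-1) \<and> (\<forall>i\<ge>0. x i = y i))"

definition right_special :: "('a \<Rightarrow> 'a list) \<Rightarrow> (int \<Rightarrow> 'a) \<Rightarrow> bool" where
  "right_special \<tau> x \<longleftrightarrow> x \<in> shift_space \<tau> \<and>
     (\<exists>y \<in> shift_space \<tau>. x 0 \<noteq> y 0 \<and> (\<forall>i\<le>-1. x i = y i))"

definition orbit_eq :: "(int \<Rightarrow> 'a) \<Rightarrow> (int \<Rightarrow> 'a) \<Rightarrow> bool" where
  "orbit_eq x y \<longleftrightarrow> (\<exists>m::int. \<forall>i. x i = y (i + m))"

definition generator :: "('a \<Rightarrow> 'a list) \<Rightarrow> 'a list \<Rightarrow> 'a list \<Rightarrow> 'a list \<Rightarrow> bool" where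
  "generator \<tau> v u w \<longleftrightarrow> v \<noteq> [] \<and> u \<noteq> [] \<and> w \<noteq> [] \<and> u \<in> lang \<tau> \<and>
     substw \<tau> u = v @ u @ w"

text \<open>Right-infinite word w tau(w) tau^2(w) ..., letter at position n (n >= 0).
 The first Suc n blocks have total length > n when w is nonempty.\<close>
definition right_inf :: "('a \<Rightarrow> 'a list) \<Rightarrow> 'a list \<Rightarrow> nat \<Rightarrow> 'a" where
  "right_inf \<tau> w n = concat (map (\<lambda>k. (substw \<tau> ^^ k) w) [0..<Suc n]) ! n"

text \<open>Left-infinite word ... tau^2(v) tau(v) v u read backwards from its last
 letter: position n corresponds to index -(n+1).\<close>
definition left_inf :: "('a \<Rightarrow> 'a list) \<Rightarrow> 'a list \<Rightarrow> 'a list \<Rightarrow> nat \<Rightarrow> 'a" where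
  "left_inf \<tau> v u n = (rev u @ concat (map (\<lambda>k. rev ((substw \<tau> ^^ k) v)) [0..<Suc n])) ! n"

definition completion :: "('a \<Rightarrow> 'a list) \<Rightarrow> 'a list \<Rightarrow> 'a list \<Rightarrow> 'a list \<Rightarrow> int \<Rightarrow> 'a" where
  "completion \<tau> v u w i = (if i \<ge> 0 then right_inf \<tau> w (nat i) else left_inf \<tau> v u (nat (- i - 1)))"

fun lcp :: "'a list \<Rightarrow> 'a list \<Rightarrow> 'a list" where
  "lcp (a # as) (b # bs) = (if a = b then a # lcp as bs else [])"
| "lcp _ _ = []"

definition lcs :: "'a list \<Rightarrow> 'a list \<Rightarrow> 'a list" where
  "lcs s t = rev (lcp (rev s) (rev t))"

definition left_segregating :: "('a \<Rightarrow> 'a list) \<Rightarrow> nat \<Rightarrow> bool" where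
  "left_segregating \<tau> k \<longleftrightarrow> k > 0 \<and>
     (\<forall>s \<in> lang_k \<tau> k. \<forall>t \<in> lang_k \<tau> k. hd s \<noteq> hd t \<longrightarrow>
        int (length (lcp (substw \<tau> s) (substw \<tau> t)))
          \<le> int (min (length (substw \<tau> s)) (length (substw \<tau> t))) - int k)"

definition right_segregating :: "('a \<Rightarrow> 'a list) \<Rightarrow> nat \<Rightarrow> bool" where
  "right_segregating \<tau> k \<longleftrightarrow> k > 0 \<and>
     (\<forall>s \<in> lang_k \<tau> k. \<forall>t \<in> lang_k \<tau> k. last s \<noteq> last t \<longrightarrow>
        int (length (lcs (substw \<tau> s) (substw \<tau> t)))
          \<le> int (min (length (substw \<tau> s)) (length (substw \<tau> t))) - int k)"

definition segregating :: "('a \<Rightarrow> 'a list) \<Rightarrow> bool" where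
  "segregating \<tau> \<longleftrightarrow> (\<exists>k. left_segregating \<tau> k) \<and> (\<exists>k. right_segregating \<tau> k)"

text \<open>A graph in which every vertex of V has exactly one outgoing edge is given by
 its successor function f; subfixed as in the paper.\<close>
definition subfixed_on :: "'v set \<Rightarrow> ('v \<Rightarrow> 'v) \<Rightarrow> bool" where
  "subfixed_on V f \<longleftrightarrow> (\<forall>x\<in>V. f x = x \<or> f (f x) = f x)"

definition ll_next :: "('a \<Rightarrow> 'a list) \<Rightarrow> 'a \<Rightarrow> 'a" where
  "ll_next \<tau> a = hd (\<tau> a)"

definition rl_next :: "('a \<Rightarrow> 'a list) \<Rightarrow> 'a \<Rightarrow> 'a" where
  "rl_next \<tau> a = last (\<tau> a)"

definition ls_vertices :: "('a \<Rightarrow> 'a list) \<Rightarrow> ('a list \<times> 'a list) set" where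
  "ls_vertices \<tau> = (let n = (LEAST k. left_segregating \<tau> k) in
     {(s, t). s \<in> lang_k \<tau> n \<and> t \<in> lang_k \<tau> n \<and> hd s \<noteq> hd t})"

definition ls_next :: "('a \<Rightarrow> 'a list) \<Rightarrow> 'a list \<times> 'a list \<Rightarrow> 'a list \<times> 'a list" where
  "ls_next \<tau> p = (let n = (LEAST k. left_segregating \<tau> k); s = fst p; t = snd p;
      c = length (lcp (substw \<tau> s) (substw \<tau> t)) in
      (take n (drop c (substw \<tau> s)), take n (drop c (substw \<tau> t))))"

definition rs_vertices :: "('a \<Rightarrow> 'a list) \<Rightarrow> ('a list \<times> 'a list) set" where
  "rs_vertices \<tau> = (let n = (LEAST k. right_segregating \<tau> k) in
     {(s, t). s \<in> lang_k \<tau> n \<and> t \<in> lang_k \<tau> n \<and> last s \<noteq> last t})"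

definition rs_next :: "('a \<Rightarrow> 'a list) \<Rightarrow> 'a list \<times> 'a list \<Rightarrow> 'a list \<times> 'a list" where
  "rs_next \<tau> p = (let n = (LEAST k. right_segregating \<tau> k); s = fst p; t = snd p;
      c = length (lcs (substw \<tau> s) (substw \<tau> t)) in
      (rev (take n (drop c (rev (substw \<tau> s)))), rev (take n (drop c (rev (substw \<tau> t))))))"

end

theory Submission
  imports Defs
begin

text \<open>
  Let x and y agree at all negative indices and differ at 0, and write both, for every p, as
  shifted images under \<open>\<tau>\<close>^p. Around index 0 only finitely many pairs of preimage words (u, v)
  of a fixed length occur, so some p has infinitely many q > p with the same pair. Applying
  \<open>\<tau>\<close>^(q-p) to the picture at level p gives two words \<open>\<tau>\<close>^q u and \<open>\<tau>\<close>^q v that agree up to a first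
  difference, as they do in x and y. If the two alignments differed, \<open>\<tau>\<close>^q v would have a long
  stretch with a comparatively short period; by linear recurrence all of the shift space would
  then be periodic, hence finite. So around 0 the pair (x, y) reproduces itself under \<open>\<tau>\<close>^(q-p)
  followed by the removal of the common prefix; no recognizability theorem is needed.
  Hence the initial words (s, t) of x and y at 0 lie on a cycle of the ls graph and are
  fixed, \<open>\<tau>\<close>(s) = c s w and \<open>\<tau>\<close>(t) = c t w'. If c or w is empty, the neighbouring letter of s in x is
  fixed in the rl or ll graph, and adjoining it to s yields the generator.
  The left special case follows by reversing words and sequences.
\<close>

section \<open>Occurrences of words in two-sided sequences\<close>

definition occurs_at :: "(int \<Rightarrow> 'a) \<Rightarrow> int \<Rightarrow> 'a list \<Rightarrow> bool" where
  "occurs_at x i z \<longleftrightarrow> (\<forall>j<length z. z ! j = x (i + int j))"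

lemma occurs_at_append:
  "occurs_at x i (u @ v) \<longleftrightarrow> occurs_at x i u \<and> occurs_at x (i + int (length u)) v"
proof (intro iffI conjI)
  assume *: "occurs_at x i (u @ v)"
  show "occurs_at x i u"
    using * unfolding occurs_at_def by (metis length_append nth_append trans_less_add1)
  show "occurs_at x (i + int (length u)) v"
    unfolding occurs_at_def
  proof (intro allI impI)
    fix j assume "j < length v"
    then show "v ! j = x (i + int (length u) + int j)"
      using *[unfolded occurs_at_def, rule_format, of "length u + j"] by (simp add: add.assoc)
  qed
next
  assume *: "occurs_at x i u \<and> occurs_at x (i + int (length u)) v"
  show "occurs_at x i (u @ v)"
    unfolding occurs_at_def
  proof (intro allI impI)
    fix j assume j: "j < length (u @ v)"
    show "(u @ v) ! j = x (i + int j)"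
    proof (cases "j < length u")
      case True
      then show ?thesis using * by (simp add: occurs_at_def nth_append)
    next
      case False
      then have "j - length u < length v" using j by simp
      then have "v ! (j - length u) = x (i + int (length u) + int (j - length u))"
        using * unfolding occurs_at_def by blast
      then show ?thesis using False by (simp add: nth_append)
    qed
  qed
qed

lemma occurs_at_unique:
  assumes "occurs_at x i u" "occurs_at x i v" "length u = length v"
  shows "u = v"
  using assms by (auto simp: occurs_at_def intro: nth_equalityI)

lemma occurs_at_seg: "i \<le> j \<Longrightarrow> occurs_at x i (seg x i j)"
  by (simp add: occurs_at_def seg_def)

lemma occurs_at_lang:
  assumes "x \<in> shift_space \<tau>" "occurs_at x i z" "z \<noteq> []"
  shows "z \<in> lang \<tau>"
proof -
  define j where "j = i + int (length z) - 1"
  have ij: "i \<le> j" using assms(3) by (cases z) (auto simp: j_def)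
  have "z = seg x i j"
    using occurs_at_seg[OF ij] assms(2)
    by (intro occurs_at_unique[of x i]) (auto simp: j_def seg_def)
  then show ?thesis using assms(1) ij by (simp add: shift_space_def)
qed

lemma append_eq_append_le:
  assumes "a @ b = c @ d" "length a \<le> length c"
  obtains e where "c = a @ e" "b = e @ d"
  using assms by (auto simp: append_eq_append_conv2)

section \<open>Iterates of a substitution and their language\<close>

lemma substw_pow_append: "(substw \<tau> ^^ p) (u @ v) = (substw \<tau> ^^ p) u @ (substw \<tau> ^^ p) v"
  by (induction p) (auto simp: substw_def)

lemma substw_pow_Nil [simp]: "(substw \<tau> ^^ p) [] = []"
  by (induction p) (auto simp: substw_def)

lemma substw_pow_add: "(substw \<tau> ^^ (p + q)) u = (substw \<tau> ^^ p) ((substw \<tau> ^^ q) u)"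
  by (simp add: funpow_add)

lemma sublist_substw_pow: "sublist u v \<Longrightarrow> sublist ((substw \<tau> ^^ p) u) ((substw \<tau> ^^ p) v)"
  by (metis sublist_def substw_pow_append)

lemma lang_sublist: "v \<in> lang \<tau> \<Longrightarrow> sublist u v \<Longrightarrow> u \<in> lang \<tau>"
  unfolding lang_def using sublist_order.order_trans by blast

lemma lang_substw_pow: "u \<in> lang \<tau> \<Longrightarrow> (substw \<tau> ^^ p) u \<in> lang \<tau>"
  unfolding lang_def
  by (smt (verit, best) mem_Collect_eq sublist_substw_pow substw_pow_add trans_le_add2)

text \<open>Pigeonhole, with the repeated value represented by an index \<open>p\<close>: discarding
  the finitely many \<open>q\<close> up to \<open>p\<close> keeps the fiber infinite. Later
  \<open>p\<close> is the reference level and each difference \<open>q - p\<close> a return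
  time.\<close>

lemma infinite_fiber:
  fixes f :: "nat \<Rightarrow> 'b"
  assumes "finite B" "\<And>p. f p \<in> B"
  obtains p where "infinite {q. p < q \<and> f q = f p}"
proof -
  have "finite (range f)" using assms by (meson finite_subset image_subsetI)
  then obtain b where b: "infinite {q. f q = b}"
    using inf_img_fin_domE[of f UNIV] by (auto simp: vimage_def)
  then obtain p where p: "f p = b" by (metis (mono_tags, lifting) Collect_empty_eq finite.emptyI)
  have "{q. f q = b} \<subseteq> {q. p < q \<and> f q = f p} \<union> {..p}" using p by auto
  then have "infinite {q. p < q \<and> f q = f p}" using b finite_subset by blast
  then show ?thesis using that by blast
qed

text \<open>A sequence of period \<open>d\<close> is determined by its values on 0 to
  \<open>d - 1\<close>, a word of length \<open>d\<close> over a finite alphabet. A period common to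
  the whole shift space therefore contradicts aperiodicity.\<close>

lemma finite_periodic_sequences:
  assumes "d > 0"
  shows "finite {x :: int \<Rightarrow> 'a::finite. \<forall>i. x i = x (i + int d)}"
proof -
  let ?X = "{x :: int \<Rightarrow> 'a. \<forall>i. x i = x (i + int d)}"
  let ?r = "\<lambda>x :: int \<Rightarrow> 'a. map (\<lambda>j. x (int j)) [0..<d]"
  have mult: "x (i + int d * k) = x i" if "x \<in> ?X" for x :: "int \<Rightarrow> 'a" and i k
  proof (induction k rule: int_induct[where k = 0])
    case (step1 k)
    have "x (i + int d * k) = x (i + int d * k + int d)" using that by blast
    then show ?case using step1 by (simp add: algebra_simps)
  next
    case (step2 k)
    have "x (i + int d * (k - 1)) = x (i + int d * (k - 1) + int d)" using that by blast
    then show ?case using step2 by (simp add: algebra_simps)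
  qed simp
  have "inj_on ?r ?X"
  proof (rule inj_onI)
    fix x y assume x: "x \<in> ?X" and y: "y \<in> ?X" and e: "?r x = ?r y"
    show "x = y"
    proof
      fix i :: int
      define j where "j = nat (i mod int d)"
      have jd: "j < d" using assms by (simp add: j_def nat_less_iff)
      have ij: "i = int j + int d * (i div int d)" using assms by (simp add: j_def)
      have "x (int j) = y (int j)" using arg_cong[OF e, of "\<lambda>l. l ! j"] jd by simp
      then show "x i = y i" using mult[OF x, of "int j" "i div int d"] mult[OF y, of "int j" "i div int d"] ij
        by metis
    qed
  qed
  moreover have "finite (?r ` ?X)"
  proof (rule finite_subset)
    show "?r ` ?X \<subseteq> {l. set l \<subseteq> UNIV \<and> length l = d}" by auto
  qed (rule finite_lists_length_eq, simp)
  ultimately show ?thesis using finite_image_iff by blast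
qed

section \<open>Length comparison and linear recurrence of a primitive substitution\<close>

locale primitive_substitution =
  fixes \<tau> :: "'a::finite \<Rightarrow> 'a list"
  assumes is_substitution: "is_substitution \<tau>" and is_primitive: "primitive \<tau>"
begin

abbreviation S :: "nat \<Rightarrow> 'a list \<Rightarrow> 'a list" where
  "S p \<equiv> substw \<tau> ^^ p"

text \<open>The unit of length at level \<open>p\<close>: later bounds have the form constant times
  \<open>maxlen p\<close>, with constants independent of \<open>p\<close>.\<close>

definition maxlen :: "nat \<Rightarrow> nat" where
  "maxlen p = Max (range (\<lambda>a. length (S p [a])))"

lemma length_substw_ge: "length u \<le> length (substw \<tau> u)"
proof (induction u)
  case (Cons a u)
  have "\<tau> a \<noteq> []" using is_substitution by (simp add: is_substitution_def)
  then have "1 \<le> length (\<tau> a)" by (cases "\<tau> a") auto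
  then show ?case using Cons by (simp add: substw_def)
qed simp

lemma length_S_Suc: "length (S p u) \<le> length (S (Suc p) u)"
  using length_substw_ge by simp

lemma length_S_mono: "p \<le> q \<Longrightarrow> length (S p u) \<le> length (S q u)"
  by (rule lift_Suc_mono_le[of "\<lambda>p. length (S p u)"]) (use length_S_Suc in auto)

lemma length_S_ge: "length u \<le> length (S p u)"
  using length_S_mono[of 0 p u] by simp

lemma S_eq_Nil [simp]: "S p u = [] \<longleftrightarrow> u = []"
  using length_S_ge[of u p] by auto

lemma length_S_letter: "length (S p [a]) \<le> maxlen p"
  unfolding maxlen_def by (intro Max_ge) auto

lemma maxlen_le: "(\<And>a. length (S p [a]) \<le> B) \<Longrightarrow> maxlen p \<le> B"
  unfolding maxlen_def by (subst Max_le_iff) auto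

lemma maxlen_pos: "maxlen p > 0"
  using length_S_letter[of p undefined] length_S_ge[of "[undefined]" p] by simp

lemma maxlen_mono: "p \<le> q \<Longrightarrow> maxlen p \<le> maxlen q"
  by (meson maxlen_le length_S_mono length_S_letter le_trans)

lemma length_S_le: "length (S p u) \<le> length u * maxlen p"
proof (induction u)
  case (Cons a u)
  then show ?case
    using length_S_letter[of p a] substw_pow_append[of p \<tau> "[a]" u] by simp
qed simp

lemma maxlen_add: "maxlen (q + p) \<le> maxlen p * maxlen q"
proof (rule maxlen_le)
  fix a
  have "length (S (q + p) [a]) \<le> length (S p [a]) * maxlen q"
    using length_S_le substw_pow_add by metis
  also have "\<dots> \<le> maxlen p * maxlen q" using length_S_letter by (simp add: mult_le_mono)
  finally show "length (S (q + p) [a]) \<le> maxlen p * maxlen q" .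
qed

lemma ex_letters_occur:
  obtains m where "m \<ge> 1" "\<And>a b j. j \<ge> m \<Longrightarrow> sublist [b] (S j [a])"
proof -
  obtain m where m: "m \<ge> 1" "\<And>a b. sublist [b] (S m [a])"
    using is_primitive unfolding primitive_def by blast
  \<comment> \<open>Primitivity speaks of a single exponent; a larger one is reached by applying
    \<open>S m\<close> to the first letter of \<open>S (j - m) [a]\<close>.\<close>
  have "sublist [b] (S j [a])" if j: "j \<ge> m" for a b j
  proof -
    obtain c r where c: "S (j - m) [a] = c # r"
      using S_eq_Nil by (metis neq_Nil_conv not_Cons_self2)
    have "S j [a] = S m [c] @ S m r"
      using substw_pow_add[of m "j - m" \<tau> "[a]"] j c substw_pow_append[of m \<tau> "[c]" r] by simp
    then show ?thesis using m(2)[of b c]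
      by (metis sublist_order.order_trans sublist_append_rightI)
  qed
  then show ?thesis using m(1) that by blast
qed

text \<open>By primitivity the lengths of all \<open>S p [a]\<close> are comparable, uniformly in
  \<open>p\<close>. For \<open>p \<ge> m\<close> the word \<open>S p [a]\<close> is the image under
  \<open>S m\<close> of \<open>S (p - m) [a]\<close>, which occurs in \<open>S p [b]\<close>; so
  \<open>K = maxlen m\<close> works. For smaller \<open>p\<close> already \<open>S p [a]\<close> is
  no longer than \<open>maxlen m\<close>.\<close>

lemma ex_ratio:
  obtains K where "K \<ge> 1" "\<And>p u. length u * maxlen p \<le> K * length (S p u)"
proof -
  obtain m where m: "m \<ge> 1" "\<And>a b j. j \<ge> m \<Longrightarrow> sublist [b] (S j [a])"
    using ex_letters_occur by metis
  have one: "maxlen p \<le> maxlen m * length (S p [b])" for p b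
  proof (rule maxlen_le)
    fix a
    show "length (S p [a]) \<le> maxlen m * length (S p [b])"
    proof (cases "p \<ge> m")
      case True
      have "S p [a] = S m (S (p - m) [a])" using True substw_pow_add[of m "p - m" \<tau> "[a]"] by simp
      then have "length (S p [a]) \<le> length (S (p - m) [a]) * maxlen m"
        using length_S_le[of m "S (p - m) [a]"] by simp
      moreover have "sublist (S (p - m) [a]) (S (p - m) (S m [b]))"
        using m(2) by (intro sublist_substw_pow) simp
      then have "length (S (p - m) [a]) \<le> length (S p [b])"
        using True substw_pow_add[of "p - m" m \<tau> "[b]"] by (simp add: sublist_length_le)
      then have "length (S (p - m) [a]) * maxlen m \<le> maxlen m * length (S p [b])" by simp
      ultimately show ?thesis by linarith
    next
      case False
      then have "length (S p [a]) \<le> maxlen m"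
        using length_S_mono[of p m "[a]"] length_S_letter[of m a] by simp
      moreover have "maxlen m * 1 \<le> maxlen m * length (S p [b])"
        using length_S_ge[of "[b]" p] by (intro mult_le_mono2) simp
      ultimately show ?thesis by linarith
    qed
  qed
  have "length u * maxlen p \<le> maxlen m * length (S p u)" for p u
  proof (induction u)
    case (Cons a u)
    have "length (S p (a # u)) = length (S p [a]) + length (S p u)"
      using substw_pow_append[of p \<tau> "[a]" u] by simp
    then show ?case
      using one[of p a] Cons by (simp add: add_mult_distrib2 add_mono)
  qed simp
  then show ?thesis using that[of "maxlen m"] maxlen_pos[of m] by simp
qed

text \<open>A letter with \<open>u\<close> in one of its iterates occurs in all late iterates of
  every letter, hence so does \<open>u\<close>. Having all late exponents lets a single one serve
  finitely many words.\<close>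

lemma lang_occurs_in_images:
  assumes "u \<in> lang \<tau>"
  obtains N where "\<And>j c. j \<ge> N \<Longrightarrow> sublist u (S j [c])"
proof -
  obtain a r where r: "sublist u (S r [a])" using assms by (auto simp: lang_def)
  obtain m where "m \<ge> 1" and m: "\<And>a b j. j \<ge> m \<Longrightarrow> sublist [b] (S j [a])"
    using ex_letters_occur by metis
  have "sublist u (S j [c])" if "j \<ge> r + m" for j c
  proof -
    have "sublist (S r [a]) (S r (S (j - r) [c]))"
      using m that by (intro sublist_substw_pow) simp
    moreover have "S r (S (j - r) [c]) = S j [c]"
      using that substw_pow_add[of r "j - r" \<tau> "[c]"] by simp
    ultimately show ?thesis using r sublist_order.order_trans[of u "S r [a]" "S j [c]"] by simp
  qed
  then show ?thesis using that by blast
qed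

text \<open>Since \<open>z\<close> occurs in \<open>S (p + Suc N) [c]\<close>, the whole word
  \<open>S (Suc N) [c]\<close> can serve as \<open>P\<close>; \<open>Suc N\<close> meets the demand
  of \<open>lang\<close> for a positive exponent. The length of \<open>P\<close> is uncontrolled and
  is cut down where it matters.\<close>

lemma lang_desubstitute:
  assumes "z \<in> lang \<tau>"
  obtains P where "P \<in> lang \<tau>" "sublist z (S p P)"
proof -
  obtain N where N: "\<And>j c. j \<ge> N \<Longrightarrow> sublist z (S j [c])"
    using lang_occurs_in_images[OF assms] by metis
  fix c :: 'a
  have "sublist z (S p (S (Suc N) [c]))"
    using N[of "p + Suc N" c] substw_pow_add[of p "Suc N" \<tau> "[c]"] by simp
  moreover have "S (Suc N) [c] \<in> lang \<tau>"
    unfolding lang_def by (intro CollectI exI[of _ c] exI[of _ "Suc N"]) simp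
  ultimately show ?thesis using that by blast
qed

lemma locate_letter:
  assumes "t < length (S p P)"
  obtains k where "k < length P" "length (S p (take k P)) \<le> t" "t < length (S p (take (Suc k) P))"
proof -
  let ?Q = "\<lambda>k. t < length (S p (take k P))"
  define k where "k = Least ?Q"
  have ex: "?Q (length P)" using assms by simp
  have k: "?Q k" unfolding k_def using LeastI[of ?Q, OF ex] .
  have kle: "k \<le> length P" unfolding k_def using Least_le[of ?Q, OF ex] .
  have "k \<noteq> 0" using k by (intro notI) simp
  then obtain k' where k': "k = Suc k'" by (cases k) auto
  have "\<not> t < length (S p (take k' P))"
    using not_less_Least[of k' ?Q] k' unfolding k_def by (metis lessI)
  then show ?thesis using that[of k'] k k' kle by simp
qed

lemma length_S_take_Suc:
  assumes "k < length P"
  shows "length (S p (take (Suc k) P)) \<le> length (S p (take k P)) + maxlen p"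
  using assms length_S_letter[of p "P ! k"]
  by (simp add: take_Suc_conv_app_nth substw_pow_append)

text \<open>The letter image covering the first position of \<open>W\<close> ends within
  \<open>maxlen p\<close> letters. The image of the next letter of the preimage then ends within
  \<open>2 * maxlen p\<close>, hence inside \<open>W\<close>.\<close>

lemma image_of_letter_occurs:
  assumes "W \<in> lang \<tau>" "length W \<ge> 2 * maxlen p"
  obtains c where "sublist (S p [c]) W"
proof -
  obtain P where P: "sublist W (S p P)" using lang_desubstitute[OF assms(1)] by blast
  then obtain ps ss where e: "S p P = ps @ W @ ss" by (auto simp: sublist_def)
  have "length W > 0" using assms(2) maxlen_pos[of p] by linarith
  then have "length ps < length (S p P)" using e by simp
  then obtain k where k: "k < length P" "length (S p (take k P)) \<le> length ps"
    "length ps < length (S p (take (Suc k) P))" using locate_letter by blast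
  have le1: "length (S p (take (Suc k) P)) \<le> length ps + maxlen p"
    using length_S_take_Suc[OF k(1), of p] k(2) by simp
  have k1: "Suc k < length P"
  proof (rule ccontr)
    assume "\<not> Suc k < length P"
    then have "length (S p P) \<le> length ps + maxlen p" using le1 by simp
    then show False using e assms(2) maxlen_pos[of p] by simp
  qed
  define c where "c = P ! Suc k"
  have P': "P = take (Suc k) P @ [c] @ drop (Suc (Suc k)) P"
    using k1 by (simp add: c_def Cons_nth_drop_Suc)
  have "S p P = S p (take (Suc k) P @ [c] @ drop (Suc (Suc k)) P)" using P' by metis
  then have e2: "ps @ W @ ss = S p (take (Suc k) P) @ S p [c] @ S p (drop (Suc (Suc k)) P)"
    using e by (simp only: substw_pow_append append_assoc)
  obtain A where A: "S p (take (Suc k) P) = ps @ A" "W @ ss = A @ S p [c] @ S p (drop (Suc (Suc k)) P)"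
    using append_eq_append_le[OF e2 less_imp_le[OF k(3)]] by metis
  have "length A + length (S p [c]) \<le> length W"
    using le1 A(1) assms(2) length_S_letter[of p c] by simp
  then have "take (length A + length (S p [c])) (W @ ss) = take (length A + length (S p [c])) W" by simp
  moreover have "take (length A + length (S p [c])) (W @ ss) = A @ S p [c]" using A(2) by simp
  ultimately have "sublist (A @ S p [c]) W" by (metis sublist_take)
  then have "sublist (S p [c]) W" by (metis sublist_append_leftI sublist_order.order_trans)
  then show ?thesis using that by blast
qed

text \<open>Linear recurrence, with one constant for all levels \<open>q\<close>. A shortest
  preimage of \<open>z\<close> under \<open>S q\<close> has bounded length, so only finitely many
  arise; all of them appear in \<open>S M [c]\<close> for every letter \<open>c\<close>, and a long
  \<open>W\<close> contains some \<open>S (q + M) [c]\<close>.\<close>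

lemma ex_recurrence:
  obtains E where "\<And>q z W. z \<in> lang \<tau> \<Longrightarrow> length z \<le> D * maxlen q \<Longrightarrow> W \<in> lang \<tau> \<Longrightarrow>
    length W \<ge> E * maxlen q \<Longrightarrow> sublist z W"
proof -
  obtain K where K: "\<And>p u. length u * maxlen p \<le> K * length (S p u)" using ex_ratio by metis
  \<comment> \<open>A shortest preimage has at most \<open>K * D\<close> inner letters by
    \<open>ex_ratio\<close>, and two outer letters whose images may stick out of
    \<open>z\<close>.\<close>
  define B where "B = K * D + 2"
  define F where "F = {u. u \<in> lang \<tau> \<and> length u \<le> B}"
  have "finite {u. set u \<subseteq> (UNIV :: 'a set) \<and> length u \<le> B}" by (rule finite_lists_length_le) simp
  then have finF: "finite F" by (rule rev_finite_subset) (auto simp: F_def)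
  have "\<exists>N. \<forall>j\<ge>N. \<forall>c. sublist u (S j [c])" if "u \<in> F" for u
    using lang_occurs_in_images[of u] that unfolding F_def mem_Collect_eq by metis
  then obtain N where N: "\<And>u j c. u \<in> F \<Longrightarrow> j \<ge> N u \<Longrightarrow> sublist u (S j [c])" by metis
  define M where "M = Max (N ` F)"
  have M: "N u \<le> M" if "u \<in> F" for u
    using finF that by (simp add: M_def)
  have "sublist z W" if z: "z \<in> lang \<tau>" "length z \<le> D * maxlen q"
    and W: "W \<in> lang \<tau>" "length W \<ge> (2 * maxlen M) * maxlen q" for q z W
  proof -
    obtain P where P: "P \<in> lang \<tau> \<and> sublist z (S q P)"
      and min: "\<And>P'. P' \<in> lang \<tau> \<and> sublist z (S q P') \<Longrightarrow> length P \<le> length P'"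
      using lang_desubstitute[OF z(1)]
        ex_has_least_nat[of "\<lambda>P. P \<in> lang \<tau> \<and> sublist z (S q P)" _ length] by metis
    have "length P \<le> B"
    proof (cases "length P \<le> 2")
      case False
      then obtain a Q' where a: "P = a # Q'" by (cases P) auto
      then have "Q' \<noteq> []" using False by auto
      then obtain Q b where PQ: "P = a # Q @ [b]" using a by (metis append_butlast_last_id)
      have 1: "\<not> sublist z (S q (a # Q))" "\<not> sublist z (S q (Q @ [b]))"
      proof -
        have "a # Q \<in> lang \<tau>" using P PQ lang_sublist[of P \<tau> "a # Q"]
          by (metis append_Cons sublist_append_rightI)
        then show "\<not> sublist z (S q (a # Q))" using min[of "a # Q"] PQ by auto
        have "Q @ [b] \<in> lang \<tau>" using P PQ lang_sublist[of P \<tau> "Q @ [b]"]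
          by (metis append_Cons append_Nil sublist_append_leftI)
        then show "\<not> sublist z (S q (Q @ [b]))" using min[of "Q @ [b]"] PQ by auto
      qed
      obtain ps ss where e: "S q P = ps @ z @ ss" using P by (auto simp: sublist_def)
      have e2: "ps @ z @ ss = S q [a] @ S q Q @ S q [b]"
        using e PQ substw_pow_append[of q \<tau> "[a]" "Q @ [b]"] substw_pow_append[of q \<tau> Q "[b]"] by simp
      \<comment> \<open>Otherwise the first letter could be dropped, against minimality; the last
        letter is treated symmetrically below.\<close>
      have "length ps < length (S q [a])"
      proof (rule ccontr)
        assume "\<not> ?thesis"
        then have "length (S q [a]) \<le> length ps" by simp
        then obtain A where "ps = S q [a] @ A" "S q Q @ S q [b] = A @ z @ ss"
          using append_eq_append_le[OF e2[symmetric]] by metis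
        then show False using 1(2) by (metis substw_pow_append sublist_appendI)
      qed
      moreover have "length ss < length (S q [b])"
      proof (rule ccontr)
        assume *: "\<not> ?thesis"
        have e3: "(ps @ z) @ ss = (S q [a] @ S q Q) @ S q [b]" using e2 by simp
        moreover have "length (ps @ z) \<le> length (S q [a] @ S q Q)"
          using * arg_cong[OF e3, of length] by simp
        ultimately obtain A where "S q [a] @ S q Q = (ps @ z) @ A"
          using append_eq_append_le by metis
        then have "S q (a # Q) = ps @ z @ A"
          using substw_pow_append[of q \<tau> "[a]" Q] by simp
        then show False using 1(1) by (metis sublist_appendI)
      qed
      moreover have "length ps + length z + length ss = length (S q [a]) + length (S q Q) + length (S q [b])"
        using arg_cong[OF e2, of length] by simp
      ultimately have "length (S q Q) \<le> D * maxlen q" using z(2) by simp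
      then have "length Q * maxlen q \<le> (K * D) * maxlen q"
        using K[of Q q] by (metis mult.assoc mult_le_mono2 order_trans)
      then have "length Q \<le> K * D" using maxlen_pos[of q] by simp
      then show ?thesis using PQ by (simp add: B_def)
    qed (simp add: B_def)
    then have PF: "P \<in> F" using P by (simp add: F_def)
    have "2 * maxlen (q + M) \<le> length W" using W(2) maxlen_add[of q M]
      by (metis (no_types, lifting) mult.assoc mult_le_mono2 order_trans)
    then obtain c where c: "sublist (S (q + M) [c]) W" using image_of_letter_occurs W(1) by blast
    have "sublist (S q P) (S q (S M [c]))" using N[OF PF M[OF PF]] by (rule sublist_substw_pow)
    then have "sublist z (S (q + M) [c])" using P
      by (metis sublist_order.order_trans substw_pow_add)
    then show ?thesis using c sublist_order.order_trans by blast
  qed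
  then show ?thesis using that[of "2 * maxlen M"] by blast
qed

text \<open>By recurrence, a long stretch of period \<open>d\<close> contains every word of length
  \<open>d + 1\<close> of the language, so the first and last letters of each such word agree. Then
  \<open>d\<close> is a period of every sequence in the shift space, which would be finite.\<close>

lemma ex_no_long_period:
  assumes "infinite (shift_space \<tau>)"
  obtains E where "\<And>q d R W. W \<in> lang \<tau> \<Longrightarrow> 0 < d \<Longrightarrow> d \<le> D * maxlen q \<Longrightarrow> E * maxlen q \<le> R \<Longrightarrow>
    R + d \<le> length W \<Longrightarrow> \<exists>i<R. W ! i \<noteq> W ! (i + d)"
proof -
  \<comment> \<open>The test words have length \<open>d + 1\<close>, and \<open>maxlen q\<close> is
    at least 1, hence \<open>D + 1\<close>.\<close>
  obtain E where E: "\<And>q z W. z \<in> lang \<tau> \<Longrightarrow> length z \<le> (D + 1) * maxlen q \<Longrightarrow> W \<in> lang \<tau> \<Longrightarrow>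
    length W \<ge> E * maxlen q \<Longrightarrow> sublist z W" using ex_recurrence[of "D + 1"] by metis
  have "\<exists>i<R. W ! i \<noteq> W ! (i + d)" if W: "W \<in> lang \<tau>" "0 < d" "d \<le> D * maxlen q"
    "E * maxlen q \<le> R" "R + d \<le> length W" for q d R W
  proof (rule ccontr)
    assume "\<not> ?thesis"
    then have per: "\<And>i. i < R \<Longrightarrow> W ! i = W ! (i + d)" by blast
    define W' where "W' = take (R + d) W"
    have W': "W' \<in> lang \<tau>" "length W' = R + d"
      using W lang_sublist[OF W(1), of W'] by (auto simp: W'_def)
    have "x i = x (i + int d)" if x: "x \<in> shift_space \<tau>" for x i
    proof -
      define z where "z = seg x i (i + int d)"
      have zl: "z \<in> lang \<tau>" using x by (simp add: z_def shift_space_def)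
      have lz: "length z = d + 1" by (simp add: z_def seg_def)
      have "length z \<le> (D + 1) * maxlen q" using lz W(3) maxlen_pos[of q] by simp
      then have "sublist z W'" using E[OF zl _ W'(1)] W'(2) W(4) by simp
      then obtain ps ss where e: "W' = ps @ z @ ss" by (auto simp: sublist_def)
      have l: "length ps < R" using W'(2) e lz by simp
      have "z ! 0 = W' ! length ps" "z ! d = W' ! (length ps + d)"
        using e lz by (auto simp: nth_append)
      then have "z ! 0 = z ! d" using per[OF l] l W(5) by (simp add: W'_def)
      moreover have "z ! 0 = x i" "z ! d = x (i + int d)"
        using occurs_at_seg[of i "i + int d" x] lz unfolding occurs_at_def z_def[symmetric] by auto
      ultimately show ?thesis by simp
    qed
    then have "shift_space \<tau> \<subseteq> {x. \<forall>i. x i = x (i + int d)}" by blast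
    then show False using finite_periodic_sequences[OF W(2)] assms finite_subset by blast
  qed
  then show ?thesis using that by blast
qed

text \<open>A finite piece of a preimage of \<open>x\<close> under \<open>S p\<close>: the image of
  the letter \<open>u ! M\<close> covers index 0, and \<open>M\<close> letters stand on each side.
  The length of \<open>u\<close> does not depend on \<open>p\<close>, so finitely many words serve
  all levels.\<close>

lemma ex_centered_preimage:
  assumes "x \<in> shift_space \<tau>"
  obtains u i where "u \<in> lang \<tau>" "length u = 2 * M + 1" "occurs_at x i (S p u)"
    "i + int (length (S p (take M u))) \<le> 0" "0 < i + int (length (S p (take (Suc M) u)))"
proof -
  \<comment> \<open>Images of \<open>M + 1\<close> letters fit into \<open>N\<close>, so the
    covering letter and its \<open>M\<close> neighbours on either side have their images inside the
    window.\<close>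
  define N where "N = (M + 1) * maxlen p"
  define z where "z = seg x (- int N) (int N)"
  have lz: "length z = 2 * N + 1" by (simp add: z_def seg_def)
  have zl: "z \<in> lang \<tau>" using assms by (simp add: z_def shift_space_def)
  have oz: "occurs_at x (- int N) z" unfolding z_def by (rule occurs_at_seg) simp
  obtain P where P: "P \<in> lang \<tau>" "sublist z (S p P)" using lang_desubstitute[OF zl] by blast
  then obtain ps ss where e: "S p P = ps @ z @ ss" by (auto simp: sublist_def)
  \<comment> \<open>The position of index 0 inside \<open>S p P\<close>.\<close>
  define t where "t = length ps + N"
  have "t < length (S p P)" using e lz by (simp add: t_def)
  then obtain k where k: "k < length P" "length (S p (take k P)) \<le> t"
    "t < length (S p (take (Suc k) P))" using locate_letter by blast
  have split: "length (S p (take j P)) + length (S p (take l (drop j P))) = length (S p (take (j + l) P))" for j l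
    by (simp add: take_add substw_pow_append)
  have len: "length (S p (take (j + l) P)) \<le> length (S p (take j P)) + l * maxlen p" for j l
  proof -
    have "length (S p (take l (drop j P))) \<le> length (take l (drop j P)) * maxlen p" by (rule length_S_le)
    also have "\<dots> \<le> l * maxlen p" by simp
    finally show ?thesis using split[of j l] by simp
  qed
  have "N < Suc k * maxlen p" using len[of 0 "Suc k"] k(3) by (simp add: t_def)
  then have "M < k" unfolding N_def using maxlen_pos[of p] by (metis Suc_eq_plus1 Suc_less_eq mult_less_cancel2)
  have kM: "k + M < length P"
  proof (rule ccontr)
    assume "\<not> ?thesis"
    then have "length (S p P) \<le> length (S p (take k P)) + M * maxlen p" using len[of k M] by simp
    then show False using k(2) e lz by (simp add: t_def N_def)
  qed
  define u where "u = take (2 * M + 1) (drop (k - M) P)"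
  define Q where "Q = take (k - M) P"
  have lu: "length u = 2 * M + 1" using kM \<open>M < k\<close> by (simp add: u_def)
  have Pe: "P = Q @ u @ drop (2 * M + 1) (drop (k - M) P)"
    unfolding u_def Q_def by (simp only: append_take_drop_id)
  have uL: "u \<in> lang \<tau>" using P(1) lang_sublist Pe by (metis sublist_appendI)
  have tM: "length (S p (take M u)) + length (S p Q) = length (S p (take k P))"
    using split[of "k - M" M] \<open>M < k\<close> by (simp add: u_def Q_def)
  have tSM: "length (S p (take (Suc M) u)) + length (S p Q) = length (S p (take (Suc k) P))"
    using split[of "k - M" "Suc M"] \<open>M < k\<close> by (simp add: u_def Q_def)
  have tu: "length (S p u) + length (S p Q) = length (S p (take (k + M + 1) P))"
    using split[of "k - M" "2 * M + 1"] \<open>M < k\<close> by (simp add: u_def Q_def add.commute)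
  have lo: "length ps < length (S p Q)"
    using len[of "k - M" "Suc M"] k(3) \<open>M < k\<close> by (simp add: Q_def t_def N_def)
  have hi: "length (S p u) + length (S p Q) \<le> length ps + length z"
    using tu len[of k "M + 1"] k(2) lz by (simp add: t_def N_def)
  define i where "i = int (length (S p Q)) - int t"
  have "occurs_at x i (S p u)"
    unfolding occurs_at_def
  proof (intro allI impI)
    fix j assume j: "j < length (S p u)"
    define r where "r = length (S p Q) + j - length ps"
    have r: "r < length z" using hi j lo by (simp add: r_def)
    have eP: "S p P = S p Q @ S p u @ S p (drop (2 * M + 1) (drop (k - M) P))"
      using Pe by (metis substw_pow_append)
    have "S p P ! (length (S p Q) + j) = S p u ! j" using eP j by (simp add: nth_append)
    moreover have "S p P ! (length (S p Q) + j) = z ! r"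
    proof -
      have "length (S p Q) + j = length ps + r" using lo by (simp add: r_def)
      then show ?thesis using e r by (simp add: nth_append)
    qed
    moreover have "z ! r = x (- int N + int r)" using oz r by (simp add: occurs_at_def)
    moreover have "- int N + int r = i + int j" using lo by (simp add: i_def r_def t_def)
    ultimately show "S p u ! j = x (i + int j)" by simp
  qed
  moreover have "i + int (length (S p (take M u))) \<le> 0" using tM k(2) by (simp add: i_def)
  moreover have "0 < i + int (length (S p (take (Suc M) u)))" using tSM k(3) by (simp add: i_def)
  ultimately show ?thesis using that uL lu by blast
qed

end

section \<open>Uniqueness of the first difference of two aligned words\<close>

lemma lcp_split:
  obtains s' t' where "s = lcp s t @ s'" "t = lcp s t @ t'"
    "s' \<noteq> [] \<Longrightarrow> t' \<noteq> [] \<Longrightarrow> hd s' \<noteq> hd t'"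
proof -
  have "\<exists>s' t'. s = lcp s t @ s' \<and> t = lcp s t @ t' \<and> (s' \<noteq> [] \<longrightarrow> t' \<noteq> [] \<longrightarrow> hd s' \<noteq> hd t')"
    by (induction s t rule: lcp.induct) auto
  then show ?thesis using that by blast
qed

text \<open>Both \<open>C\<close> and \<open>C'\<close> stop exactly where the two given words first
  differ, a place determined by the words alone.\<close>

lemma first_difference_unique:
  assumes "C @ s @ W = C' @ s' @ V" "C @ t @ W' = C' @ t' @ V'"
    and "s \<noteq> []" "t \<noteq> []" "s' \<noteq> []" "t' \<noteq> []" "hd s \<noteq> hd t" "hd s' \<noteq> hd t'"
  shows "C = C'"
  using assms
proof (induction C arbitrary: C')
  case Nil
  then show ?case by (cases C'; cases s; cases t) auto
next
  case (Cons c C)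
  show ?case
  proof (cases C')
    case Nil
    then show ?thesis using Cons.prems by (cases s'; cases t') simp_all
  next
    case (Cons c' D)
    have "C @ s @ W = D @ s' @ V" "C @ t @ W' = D @ t' @ V'" "c = c'"
      using Cons.prems(1,2) Cons by simp_all
    then show ?thesis using Cons.IH[of D] Cons.prems(3-) Cons by simp
  qed
qed

text \<open>Going back from \<open>a1\<close> in \<open>U\<close> and \<open>a2\<close> in
  \<open>V\<close> gives one matching, going back from \<open>b1\<close> and \<open>b2\<close>
  another. If their offsets differ, passing from \<open>V\<close> to \<open>U\<close> by the first
  and back by the second matches \<open>V\<close> with its own shift by \<open>e\<close>, a period
  over \<open>R\<close> positions.\<close>

lemma no_shifted_matches:
  fixes U V :: "'a list" and a1 a2 b1 b2 d R :: nat
  assumes a: "\<And>j. 1 \<le> j \<Longrightarrow> j \<le> a1 \<Longrightarrow> j \<le> a2 \<Longrightarrow> U ! (a1 - j) = V ! (a2 - j)"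
    and b: "\<And>j. 1 \<le> j \<Longrightarrow> j \<le> b1 \<Longrightarrow> j \<le> b2 \<Longrightarrow> U ! (b1 - j) = V ! (b2 - j)"
    and large: "R + 2 * d \<le> a1" "R + 2 * d \<le> a2" "R + 2 * d \<le> b1" "R + 2 * d \<le> b2"
    and close: "a1 \<le> b1 + d" "b1 \<le> a1 + d" "a2 \<le> b2 + d" "b2 \<le> a2 + d"
    and "b2 \<le> length V"
    and noper: "\<And>i0 e. 0 < e \<Longrightarrow> e \<le> 2 * d \<Longrightarrow> i0 + R + e \<le> length V \<Longrightarrow>
      \<exists>i<R. V ! (i0 + i) \<noteq> V ! (i0 + i + e)"
  shows "\<not> b1 + a2 < a1 + b2"
proof
  assume lt: "b1 + a2 < a1 + b2"
  define e where "e = a1 + b2 - (b1 + a2)"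
  \<comment> \<open>The distances \<open>j\<close> back from \<open>a2\<close> then run from
    \<open>d + 1\<close> to \<open>R + d\<close>. As \<open>a1\<close> and \<open>b1\<close> differ
    by at most \<open>d\<close>, the distances \<open>j'\<close> back from \<open>b1\<close> stay
    between 1 and \<open>R + 2 * d\<close>.\<close>
  define i0 where "i0 = a2 - R - d"
  have "0 < e" "e \<le> 2 * d" "i0 + R + e \<le> length V"
    using lt close large \<open>b2 \<le> length V\<close> by (auto simp: e_def i0_def)
  then obtain i where i: "i < R" "V ! (i0 + i) \<noteq> V ! (i0 + i + e)" using noper by blast
  define j where "j = R + d - i"
  define j' where "j' = j + b1 - a1"
  have "1 \<le> j" "j \<le> a1" "j \<le> a2" "1 \<le> j'" "j' \<le> b1" "j' \<le> b2"
    using i(1) large close by (auto simp: j_def j'_def)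
  then have "U ! (a1 - j) = V ! (a2 - j)" "U ! (b1 - j') = V ! (b2 - j')" using a b by auto
  moreover have "a1 - j = b1 - j'" "a2 - j = i0 + i" "b2 - j' = i0 + i + e"
    using i(1) large close lt by (auto simp: j_def j'_def i0_def e_def)
  ultimately show False using i(2) by simp
qed

text \<open>The preceding lemma, used in both directions, makes the offsets equal. On a common
  diagonal the earlier of two distinct mismatches would lie where the other matching demands
  equality.\<close>

lemma matching_positions_unique:
  fixes U V :: "'a list" and a1 a2 b1 b2 d R :: nat
  assumes a: "\<And>j. 1 \<le> j \<Longrightarrow> j \<le> a1 \<Longrightarrow> j \<le> a2 \<Longrightarrow> U ! (a1 - j) = V ! (a2 - j)"
    and b: "\<And>j. 1 \<le> j \<Longrightarrow> j \<le> b1 \<Longrightarrow> j \<le> b2 \<Longrightarrow> U ! (b1 - j) = V ! (b2 - j)"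
    and neq: "U ! a1 \<noteq> V ! a2" "U ! b1 \<noteq> V ! b2"
    and large: "R + 2 * d \<le> a1" "R + 2 * d \<le> a2" "R + 2 * d \<le> b1" "R + 2 * d \<le> b2"
    and close: "a1 \<le> b1 + d" "b1 \<le> a1 + d" "a2 \<le> b2 + d" "b2 \<le> a2 + d"
    and len: "a2 \<le> length V" "b2 \<le> length V"
    and noper: "\<And>i0 e. 0 < e \<Longrightarrow> e \<le> 2 * d \<Longrightarrow> i0 + R + e \<le> length V \<Longrightarrow>
      \<exists>i<R. V ! (i0 + i) \<noteq> V ! (i0 + i + e)"
  shows "a1 = b1 \<and> a2 = b2"
proof -
  have "\<not> b1 + a2 < a1 + b2"
    by (rule no_shifted_matches[of a1 a2 U V b1 b2 R d]) (use a b large close len noper in auto)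
  moreover have "\<not> a1 + b2 < b1 + a2"
    by (rule no_shifted_matches[of b1 b2 U V a1 a2 R d]) (use a b large close len noper in auto)
  ultimately have eq: "a1 + b2 = b1 + a2" by simp
  have "\<not> a1 < b1"
  proof
    assume "a1 < b1"
    moreover have "1 \<le> b1 - a1 \<and> b1 - a1 \<le> b1 \<and> b1 - a1 \<le> b2 \<and> b1 - (b1 - a1) = a1 \<and> b2 - (b1 - a1) = a2"
      using calculation eq by arith
    ultimately show False using b[of "b1 - a1"] neq(1) by metis
  qed
  moreover have "\<not> b1 < a1"
  proof
    assume "b1 < a1"
    moreover have "1 \<le> a1 - b1 \<and> a1 - b1 \<le> a1 \<and> a1 - b1 \<le> a2 \<and> a1 - (a1 - b1) = b1 \<and> a2 - (a1 - b1) = b2"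
      using calculation eq by arith
    ultimately show False using a[of "a1 - b1"] neq(2) by metis
  qed
  ultimately show ?thesis using eq by simp
qed

lemma common_past_suffix:
  assumes "occurs_at x (- int (length g1)) g1" "occurs_at y (- int (length g2)) g2"
    and past: "\<And>i. i \<le> -1 \<Longrightarrow> x i = y i" and le: "length g1 \<le> length g2"
  obtains e where "g2 = e @ g1"
proof -
  define e f where "e = take (length g2 - length g1) g2" and "f = drop (length g2 - length g1) g2"
  have g2: "g2 = e @ f" by (simp add: e_def f_def)
  have lf: "length f = length g1" using le by (simp add: f_def)
  have "occurs_at y (- int (length g2) + int (length e)) f"
    using assms(2) g2 occurs_at_append by metis
  moreover have "- int (length g2) + int (length e) = - int (length g1)"
    using le by (simp add: e_def)
  ultimately have of: "occurs_at y (- int (length g1)) f" by simp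
  have "f = g1"
  proof (rule nth_equalityI)
    fix j assume j: "j < length f"
    then show "f ! j = g1 ! j"
      using of assms(1) lf past[of "- int (length g1) + int j"] by (simp add: occurs_at_def)
  qed (rule lf)
  then show ?thesis using g2 that by blast
qed

text \<open>Of two words ending at index -1 in sequences with a common past, one is a suffix of the
  other; this survives iterating \<open>\<tau>\<close> and appending a common \<open>C\<close>. With
  \<open>k = 0\<close> and empty \<open>C\<close> it covers the cut of the sequences
  themselves.\<close>

lemma common_past_nth:
  assumes g: "occurs_at x (- int (length g1)) g1" "occurs_at y (- int (length g2)) g2"
    and past: "\<And>i. i \<le> -1 \<Longrightarrow> x i = y i"
    and U: "U = (substw \<tau> ^^ k) g1 @ C @ H1" and V: "V = (substw \<tau> ^^ k) g2 @ C @ H2"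
    and a1: "a1 = length ((substw \<tau> ^^ k) g1) + length C"
    and a2: "a2 = length ((substw \<tau> ^^ k) g2) + length C"
    and j: "1 \<le> j" "j \<le> a1" "j \<le> a2"
  shows "U ! (a1 - j) = V ! (a2 - j)"
proof -
  have nth: "(G' @ H') ! (length G' - j) = (G @ H) ! (length G - j)"
    if "G' = e @ G" "j \<le> length G" for G G' H H' e :: "'a list"
    using that j(1) by (auto simp: nth_append)
  show ?thesis
  proof (cases "length g1 \<le> length g2")
    case True
    then obtain e where "g2 = e @ g1" using common_past_suffix[OF g past] by metis
    then have "(substw \<tau> ^^ k) g2 @ C = (substw \<tau> ^^ k) e @ ((substw \<tau> ^^ k) g1 @ C)"
      by (simp add: substw_pow_append)
    from nth[OF this, of H2 H1] show ?thesis using j U V a1 a2 by simp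
  next
    case False
    then have le: "length g2 \<le> length g1" by simp
    have past': "\<And>i. i \<le> -1 \<Longrightarrow> y i = x i" using past by simp
    obtain e where "g1 = e @ g2" using common_past_suffix[OF g(2,1) past' le] by metis
    then have "(substw \<tau> ^^ k) g1 @ C = (substw \<tau> ^^ k) e @ ((substw \<tau> ^^ k) g2 @ C)"
      by (simp add: substw_pow_append)
    from nth[OF this, of H1 H2] show ?thesis using j U V a1 a2 by simp
  qed
qed

lemma occurs_at_take:
  assumes "occurs_at x 0 h" "n \<le> length h"
  shows "take n h = map (\<lambda>j. x (int j)) [0..<n]"
  using assms by (intro nth_equalityI) (auto simp: occurs_at_def)

section \<open>Subfixed graphs and walks in the ls graph\<close>

lemma funpow_subfixed_return:
  assumes "subfixed_on V f" "p \<in> V" "(f ^^ k) p = p" "k \<ge> 1"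
  shows "f p = p"
proof -
  have "f p = p \<or> f (f p) = f p" using assms(1,2) by (simp add: subfixed_on_def)
  then show ?thesis
  proof
    assume *: "f (f p) = f p"
    \<comment> \<open>After one step the orbit is constant, so a return to \<open>p\<close> makes
      \<open>p\<close> that constant.\<close>
    have "(f ^^ Suc j) p = f p" for j by (induction j) (simp_all add: *)
    then show ?thesis using assms(3,4) by (metis Suc_diff_le diff_Suc_1)
  qed
qed

text \<open>The segregating bound leaves at least \<open>n\<close> letters of each image after the
  common prefix. Cutting to \<open>n\<close> letters thus yields words of full length with different
  first letters, again a vertex.\<close>

lemma ls_next_step:
  assumes seg: "\<exists>k. left_segregating \<tau> k" and p: "p \<in> ls_vertices \<tau>"
  obtains C W W' where "substw \<tau> (fst p) = C @ fst (ls_next \<tau> p) @ W"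
    "substw \<tau> (snd p) = C @ snd (ls_next \<tau> p) @ W'" "ls_next \<tau> p \<in> ls_vertices \<tau>"
proof -
  define n where "n = (LEAST k. left_segregating \<tau> k)"
  obtain s t where st: "p = (s, t)" by (cases p)
  have ns: "left_segregating \<tau> n" unfolding n_def using seg by (rule LeastI_ex)
  have v: "s \<in> lang_k \<tau> n" "t \<in> lang_k \<tau> n" "hd s \<noteq> hd t"
    using p st unfolding ls_vertices_def Let_def n_def by auto
  obtain s' t' where c: "substw \<tau> s = lcp (substw \<tau> s) (substw \<tau> t) @ s'"
     "substw \<tau> t = lcp (substw \<tau> s) (substw \<tau> t) @ t'"
    "s' \<noteq> [] \<Longrightarrow> t' \<noteq> [] \<Longrightarrow> hd s' \<noteq> hd t'" using lcp_split by blast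
  define C where "C = lcp (substw \<tau> s) (substw \<tau> t)"
  have cs: "substw \<tau> s = C @ s'" and ct: "substw \<tau> t = C @ t'" using c unfolding C_def by simp_all
  have "int (length C) \<le> int (min (length (substw \<tau> s)) (length (substw \<tau> t))) - int n"
    using ns v unfolding left_segregating_def C_def by blast
  then have len: "n \<le> length s'" "n \<le> length t'" unfolding cs ct by auto
  have n0: "n > 0" using ns by (simp add: left_segregating_def)
  have nx: "ls_next \<tau> p = (take n s', take n t')"
    unfolding ls_next_def Let_def st n_def[symmetric] fst_conv snd_conv C_def[symmetric]
    by (simp add: cs ct)
  have "take n s' \<in> lang \<tau>"
  proof (rule lang_sublist)
    show "substw \<tau> s \<in> lang \<tau>" using lang_substw_pow[of s \<tau> 1] v by (simp add: lang_k_def)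
    show "sublist (take n s') (substw \<tau> s)" unfolding cs
      by (metis sublist_append_leftI sublist_order.order_trans sublist_take)
  qed
  moreover have "take n t' \<in> lang \<tau>"
  proof (rule lang_sublist)
    show "substw \<tau> t \<in> lang \<tau>" using lang_substw_pow[of t \<tau> 1] v by (simp add: lang_k_def)
    show "sublist (take n t') (substw \<tau> t)" unfolding ct
      by (metis sublist_append_leftI sublist_order.order_trans sublist_take)
  qed
  moreover have "hd (take n s') \<noteq> hd (take n t')"
  proof -
    have "s' \<noteq> []" "t' \<noteq> []" using len n0 by auto
    then show ?thesis using c(3) n0 by simp
  qed
  ultimately have "ls_next \<tau> p \<in> ls_vertices \<tau>"
    unfolding ls_vertices_def Let_def n_def[symmetric] nx using len by (simp add: lang_k_def)
  moreover have "substw \<tau> (fst p) = C @ fst (ls_next \<tau> p) @ drop n s'"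
    "substw \<tau> (snd p) = C @ snd (ls_next \<tau> p) @ drop n t'"
    using cs ct nx st by simp_all
  ultimately show ?thesis using that by blast
qed

text \<open>The prefixes removed along a walk accumulate to one word \<open>C\<close> common to both
  images. As the end of the walk is a vertex, \<open>C\<close> ends where the two images first
  differ.\<close>

lemma ls_next_iterate:
  assumes seg: "\<exists>k. left_segregating \<tau> k" and p: "p \<in> ls_vertices \<tau>"
  shows "(ls_next \<tau> ^^ k) p \<in> ls_vertices \<tau> \<and>
    (\<exists>C W W'. (substw \<tau> ^^ k) (fst p) = C @ fst ((ls_next \<tau> ^^ k) p) @ W \<and>
      (substw \<tau> ^^ k) (snd p) = C @ snd ((ls_next \<tau> ^^ k) p) @ W')"
proof (induction k)
  case 0
  have "(substw \<tau> ^^ 0) (fst p) = [] @ fst ((ls_next \<tau> ^^ 0) p) @ [] \<and>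
      (substw \<tau> ^^ 0) (snd p) = [] @ snd ((ls_next \<tau> ^^ 0) p) @ []" by simp
  then show ?case using p by (metis funpow_0)
next
  case (Suc k)
  define r where "r = (ls_next \<tau> ^^ k) p"
  have r: "r \<in> ls_vertices \<tau>" using Suc r_def by simp
  obtain C W W' where C: "(substw \<tau> ^^ k) (fst p) = C @ fst r @ W"
    "(substw \<tau> ^^ k) (snd p) = C @ snd r @ W'" using Suc unfolding r_def by blast
  obtain C1 W1 W1' where C1: "substw \<tau> (fst r) = C1 @ fst (ls_next \<tau> r) @ W1"
    "substw \<tau> (snd r) = C1 @ snd (ls_next \<tau> r) @ W1'" "ls_next \<tau> r \<in> ls_vertices \<tau>"
    using ls_next_step[OF seg r] by metis
  have app: "substw \<tau> (u @ v) = substw \<tau> u @ substw \<tau> v" for u v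
    by (simp add: substw_def)
  have "(substw \<tau> ^^ Suc k) (fst p) = (substw \<tau> C @ C1) @ fst (ls_next \<tau> r) @ (W1 @ substw \<tau> W)"
    "(substw \<tau> ^^ Suc k) (snd p) = (substw \<tau> C @ C1) @ snd (ls_next \<tau> r) @ (W1' @ substw \<tau> W')"
    using C C1(1,2) by (simp_all add: app)
  moreover have "(ls_next \<tau> ^^ Suc k) p = ls_next \<tau> r" by (simp add: r_def)
  ultimately show ?case using C1(3) by metis
qed

section \<open>Self-similarity of a right special pair\<close>

context primitive_substitution
begin

text \<open>The image of the centered preimage is cut at index 0 into a past \<open>g\<close> and a
  future \<open>h\<close>. The last two bounds locate \<open>length (S k g)\<close> up to
  \<open>maxlen (k + p)\<close> in terms of \<open>u\<close> and \<open>k + p\<close> alone, which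
  keeps cuts coming from different levels close together.\<close>

lemma centered_split:
  assumes occ: "occurs_at x i (S p u)" and lu: "length u = 2 * M + 1"
    and lo: "i + int (length (S p (take M u))) \<le> 0"
    and hi: "0 < i + int (length (S p (take (Suc M) u)))"
  obtains g h where "S p u = g @ h" "i = - int (length g)" "occurs_at x (- int (length g)) g"
    "occurs_at x 0 h" "M \<le> length g" "M < length h"
    "\<And>k. length (S (k + p) (take M u)) \<le> length (S k g)"
    "\<And>k. length (S k g) \<le> length (S (k + p) (take M u)) + maxlen (k + p)"
proof -
  define g h where "g = take (nat (- i)) (S p u)" and "h = drop (nat (- i)) (S p u)"
  have gh: "S p u = g @ h" by (simp add: g_def h_def)
  have e1: "S p u = S p (take (Suc M) u) @ S p (drop (Suc M) u)"
    by (metis append_take_drop_id substw_pow_append)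
  have e2: "S p u = S p (take M u) @ S p (drop M u)"
    by (metis append_take_drop_id substw_pow_append)
  have "nat (- i) < length (S p (take (Suc M) u))" using hi lo by linarith
  moreover have lSu: "length (S p u) = length (S p (take (Suc M) u)) + length (S p (drop (Suc M) u))"
    using e1 by (metis length_append)
  ultimately have lg: "length g = nat (- i)" by (simp add: g_def)
  have i0: "i \<le> 0" using lo by linarith
  have i: "i = - int (length g)" using lg i0 by simp
  have lg1: "length (S p (take M u)) \<le> length g" using lo i by linarith
  have lg2: "length g < length (S p (take (Suc M) u))" using hi i by linarith
  obtain r where r: "g = S p (take M u) @ r"
    using append_eq_append_le[OF _ lg1] e2 gh by metis
  obtain r' where r': "S p (take (Suc M) u) = g @ r'"
    using append_eq_append_le[OF _ less_imp_le[OF lg2]] e1 gh by metis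
  have "length (take M u) \<le> length (S p (take M u))" by (rule length_S_ge)
  then have Mg: "M \<le> length g" using lg1 lu by simp
  have "length (drop (Suc M) u) \<le> length (S p (drop (Suc M) u))" by (rule length_S_ge)
  moreover have "length (S p u) = length g + length h" using gh by simp
  ultimately have Mh: "M < length h" using lSu lg2 lu by simp
  have occs: "occurs_at x (- int (length g)) g" "occurs_at x 0 h"
    using occ unfolding gh occurs_at_append i by auto
  have b1: "length (S (k + p) (take M u)) \<le> length (S k g)" for k
    unfolding r by (simp add: substw_pow_add substw_pow_append)
  have b2: "length (S k g) \<le> length (S (k + p) (take M u)) + maxlen (k + p)" for k
  proof -
    have "length (S k g) \<le> length (S k (S p (take (Suc M) u)))"
      unfolding r' by (simp add: substw_pow_append)
    also have "\<dots> = length (S (k + p) (take (Suc M) u))" by (simp add: substw_pow_add)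
    also have "\<dots> \<le> length (S (k + p) (take M u)) + maxlen (k + p)"
      using lu by (intro length_S_take_Suc) simp
    finally show ?thesis .
  qed
  show ?thesis using that gh i occs Mg Mh b1 b2 by blast
qed

text \<open>Levels \<open>p\<close> and \<open>q = p + k\<close> with the same preimages give two
  cuts of \<open>S q (u p)\<close> and \<open>S q (v p)\<close>: the image under \<open>S k\<close>
  of the cut at level \<open>p\<close>, advanced by the prefix \<open>C\<close> of the walk, and the
  cut at index 0 at level \<open>q\<close>. Both are mismatches after a long common past, so they
  coincide and the walk returns to \<open>(s, t)\<close>. The letters at -1 and \<open>n\<close> are
  carried along because they may have to be adjoined to \<open>s\<close>.\<close>

lemma right_special_self_similar:
  assumes inf: "infinite (shift_space \<tau>)" and seg: "\<exists>k. left_segregating \<tau> k"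
    and x: "x \<in> shift_space \<tau>" and y: "y \<in> shift_space \<tau>"
    and neq: "x 0 \<noteq> y 0" and past: "\<And>i. i \<le> -1 \<Longrightarrow> x i = y i"
    and n: "n = (LEAST k. left_segregating \<tau> k)"
    and s: "s = map (\<lambda>j. x (int j)) [0..<n]" and t: "t = map (\<lambda>j. y (int j)) [0..<n]"
  shows "(s, t) \<in> ls_vertices \<tau>"
    and "infinite {k. k \<ge> 1 \<and> (ls_next \<tau> ^^ k) (s, t) = (s, t) \<and>
      (\<exists>C W W'. S k s = C @ s @ W \<and> S k t = C @ t @ W' \<and>
        occurs_at x (- int (length (S k [x (-1)])) - int (length C)) (S k ([x (-1)] @ s @ [x (int n)])))}"
proof -
  have "left_segregating \<tau> n" unfolding n using seg by (rule LeastI_ex)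
  then have n0: "n > 0" by (simp add: left_segregating_def)
  have ls: "length s = n" "length t = n" by (simp_all add: s t)
  have occ_s: "occurs_at x 0 s" "occurs_at y 0 t" by (simp_all add: occurs_at_def s t)
  have ne: "s \<noteq> []" "t \<noteq> []" using ls n0 by auto
  have hds: "hd s = x 0" "hd t = y 0" using n0 by (simp_all add: s t hd_map)
  have sL: "s \<in> lang \<tau>" "t \<in> lang \<tau>"
    using occurs_at_lang[OF x occ_s(1) ne(1)] occurs_at_lang[OF y occ_s(2) ne(2)] by auto
  show vert: "(s, t) \<in> ls_vertices \<tau>"
    unfolding ls_vertices_def Let_def n[symmetric] using sL ls hds neq by (simp add: lang_k_def)
  \<comment> \<open>Two candidate cuts will differ by at most \<open>(n + 1) * maxlen q\<close>; the
    period created by unequal offsets is at most twice that.\<close>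
  define D where "D = 2 * (n + 1)"
  obtain E where E: "\<And>q d R W. W \<in> lang \<tau> \<Longrightarrow> 0 < d \<Longrightarrow> d \<le> D * maxlen q \<Longrightarrow> E * maxlen q \<le> R \<Longrightarrow>
    R + d \<le> length W \<Longrightarrow> \<exists>i<R. W ! i \<noteq> W ! (i + d)"
    using ex_no_long_period[OF inf, of D] by metis
  obtain K where K: "K \<ge> 1" "\<And>p u. length u * maxlen p \<le> K * length (S p u)" using ex_ratio by metis
  \<comment> \<open>At every level \<open>q\<close> the images of \<open>M\<close> letters have
    total length at least \<open>(E + D) * maxlen q\<close>, enough past for the period
    argument.\<close>
  define M where "M = K * (E + D)"
  have "1 * D \<le> K * D" using K(1) by (rule mult_le_mono1)
  then have Mn: "n + 1 \<le> M" by (simp add: M_def D_def algebra_simps)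
  have big: "E * maxlen q + D * maxlen q \<le> length (S q (take M u))" if "length u = 2 * M + 1" for q u
  proof -
    have "M * maxlen q \<le> K * length (S q (take M u))" using K(2)[of "take M u" q] that by simp
    then have "K * ((E + D) * maxlen q) \<le> K * length (S q (take M u))" by (simp add: M_def mult.assoc)
    then have "(E + D) * maxlen q \<le> length (S q (take M u))" using K(1) by simp
    then show ?thesis by (simp add: add_mult_distrib)
  qed
  have "\<exists>u i. u \<in> lang \<tau> \<and> length u = 2 * M + 1 \<and> occurs_at x i (S p u) \<and>
    i + int (length (S p (take M u))) \<le> 0 \<and> 0 < i + int (length (S p (take (Suc M) u)))" for p
    using ex_centered_preimage[OF x, of M p] by metis
  then obtain u i where u: "\<And>p. u p \<in> lang \<tau>" "\<And>p. length (u p) = 2 * M + 1"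
    "\<And>p. occurs_at x (i p) (S p (u p))" "\<And>p. i p + int (length (S p (take M (u p)))) \<le> 0"
    "\<And>p. 0 < i p + int (length (S p (take (Suc M) (u p))))" by metis
  have "\<exists>v i. v \<in> lang \<tau> \<and> length v = 2 * M + 1 \<and> occurs_at y i (S p v) \<and>
    i + int (length (S p (take M v))) \<le> 0 \<and> 0 < i + int (length (S p (take (Suc M) v)))" for p
    using ex_centered_preimage[OF y, of M p] by metis
  then obtain v i' where v: "\<And>p. v p \<in> lang \<tau>" "\<And>p. length (v p) = 2 * M + 1"
    "\<And>p. occurs_at y (i' p) (S p (v p))" "\<And>p. i' p + int (length (S p (take M (v p)))) \<le> 0"
    "\<And>p. 0 < i' p + int (length (S p (take (Suc M) (v p))))" by metis
  let ?F = "{l :: 'a list. set l \<subseteq> UNIV \<and> length l = 2 * M + 1}"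
  have "finite (?F \<times> ?F)" by (intro finite_cartesian_product finite_lists_length_eq) simp_all
  moreover have "(u p, v p) \<in> ?F \<times> ?F" for p using u(2) v(2) by simp
  \<comment> \<open>All preimages have the fixed length \<open>2 * M + 1\<close>, so some pair
    recurs at infinitely many levels.\<close>
  ultimately obtain p where p: "infinite {q. p < q \<and> (u q, v q) = (u p, v p)}"
    by (rule infinite_fiber[of "?F \<times> ?F" "\<lambda>p. (u p, v p)"]) blast
  let ?G = "{k. k \<ge> 1 \<and> (ls_next \<tau> ^^ k) (s, t) = (s, t) \<and>
      (\<exists>C W W'. S k s = C @ s @ W \<and> S k t = C @ t @ W' \<and>
        occurs_at x (- int (length (S k [x (-1)])) - int (length C)) (S k ([x (-1)] @ s @ [x (int n)])))}"
  obtain g1 h1 where gh1: "S p (u p) = g1 @ h1" "occurs_at x (- int (length g1)) g1"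
    "occurs_at x 0 h1" "M \<le> length g1" "M < length h1"
    "\<And>k. length (S (k + p) (take M (u p))) \<le> length (S k g1)"
    "\<And>k. length (S k g1) \<le> length (S (k + p) (take M (u p))) + maxlen (k + p)"
    using centered_split[OF u(3) u(2) u(4) u(5), of p] by metis
  obtain g2 h2 where gh2: "S p (v p) = g2 @ h2" "occurs_at y (- int (length g2)) g2"
    "occurs_at y 0 h2" "M \<le> length g2" "M < length h2"
    "\<And>k. length (S (k + p) (take M (v p))) \<le> length (S k g2)"
    "\<And>k. length (S k g2) \<le> length (S (k + p) (take M (v p))) + maxlen (k + p)"
    using centered_split[OF v(3) v(2) v(4) v(5), of p] by metis
  have g1: "g1 = butlast g1 @ [x (-1)]"
  proof -
    have "g1 \<noteq> []" using gh1(4) Mn by auto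
    moreover have "last g1 = x (-1)"
      using gh1(2) calculation by (simp add: occurs_at_def last_conv_nth Suc_leI)
    ultimately show ?thesis by (metis append_butlast_last_id)
  qed
  have hs: "h1 = s @ drop n h1" "h2 = t @ drop n h2"
  proof -
    have "take n h1 = s" "take n h2 = t"
      using occurs_at_take[OF gh1(3), of n] occurs_at_take[OF gh2(3), of n] gh1(5) gh2(5) Mn
      by (simp_all add: s t)
    then show "h1 = s @ drop n h1" "h2 = t @ drop n h2" by (metis append_take_drop_id)+
  qed
  have "q - p \<in> ?G" if q: "q \<in> {q. p < q \<and> (u q, v q) = (u p, v p)}" for q
  proof -
    define k where "k = q - p"
    have pq: "p < q" and uq: "u q = u p" and vq: "v q = v p" using q by auto
    have k1: "k \<ge> 1" and kp: "k + p = q" using pq by (auto simp: k_def)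
    obtain g1' h1' where gh1': "S q (u p) = g1' @ h1'" "i q = - int (length g1')"
      "occurs_at x (- int (length g1')) g1'"
      "occurs_at x 0 h1'" "M \<le> length g1'" "M < length h1'"
      "\<And>k. length (S (k + q) (take M (u p))) \<le> length (S k g1')"
      "\<And>k. length (S k g1') \<le> length (S (k + q) (take M (u p))) + maxlen (k + q)"
      using centered_split[OF u(3) u(2) u(4) u(5), of q] unfolding uq by metis
    obtain g2' h2' where gh2': "S q (v p) = g2' @ h2'"
      "occurs_at y (- int (length g2')) g2'"
      "occurs_at y 0 h2'" "M \<le> length g2'" "M < length h2'"
      "\<And>k. length (S (k + q) (take M (v p))) \<le> length (S k g2')"
      "\<And>k. length (S k g2') \<le> length (S (k + q) (take M (v p))) + maxlen (k + q)"
      using centered_split[OF v(3) v(2) v(4) v(5), of q] unfolding vq by metis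
    define s' t' where "s' = fst ((ls_next \<tau> ^^ k) (s, t))" and "t' = snd ((ls_next \<tau> ^^ k) (s, t))"
    obtain C W W' where CW: "S k s = C @ s' @ W" "S k t = C @ t' @ W'" and vert': "(s', t') \<in> ls_vertices \<tau>"
      using ls_next_iterate[OF seg vert, of k] unfolding s'_def t'_def by auto
    have st': "length s' = n" "length t' = n" "hd s' \<noteq> hd t'"
      using vert' unfolding ls_vertices_def Let_def n[symmetric] by (auto simp: lang_k_def)
    have ne': "s' \<noteq> []" "t' \<noteq> []" using st' n0 by auto
    define H1 H2 where "H1 = s' @ W @ S k (drop n h1)" and "H2 = t' @ W' @ S k (drop n h2)"
    have "S q (u p) = S k g1 @ S k h1"
      using gh1(1) kp substw_pow_add[of k p \<tau> "u p"] by (simp add: substw_pow_append)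
    also have "S k h1 = C @ H1"
      using hs(1) CW(1) substw_pow_append[of k \<tau> s "drop n h1"] by (simp add: H1_def)
    finally have U: "S q (u p) = S k g1 @ C @ H1" .
    have "S q (v p) = S k g2 @ S k h2"
      using gh2(1) kp substw_pow_add[of k p \<tau> "v p"] by (simp add: substw_pow_append)
    also have "S k h2 = C @ H2"
      using hs(2) CW(2) substw_pow_append[of k \<tau> t "drop n h2"] by (simp add: H2_def)
    finally have V: "S q (v p) = S k g2 @ C @ H2" .
    \<comment> \<open>\<open>a1\<close> and \<open>a2\<close> are the cuts predicted from level
      \<open>p\<close>; \<open>b1\<close> and \<open>b2\<close> are the positions of index 0 at
      level \<open>q\<close>.\<close>
    define a1 a2 b1 b2 where "a1 = length (S k g1) + length C" and "a2 = length (S k g2) + length C"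
      and "b1 = length g1'" and "b2 = length g2'"
    have "length C \<le> length (S k s)" using CW(1) by simp
    also have "\<dots> \<le> n * maxlen k" using length_S_le[of k s] ls by simp
    also have "\<dots> \<le> n * maxlen q" using maxlen_mono[of k q] by (simp add: k_def)
    finally have lC: "length C \<le> n * maxlen q" .
    have "a1 = b1 \<and> a2 = b2"
    proof (rule matching_positions_unique[of a1 a2 "S q (u p)" "S q (v p)" b1 b2
          "E * maxlen q" "(n + 1) * maxlen q"])
      show "\<And>j. 1 \<le> j \<Longrightarrow> j \<le> a1 \<Longrightarrow> j \<le> a2 \<Longrightarrow> S q (u p) ! (a1 - j) = S q (v p) ! (a2 - j)"
        by (rule common_past_nth[OF gh1(2) gh2(2) past U V a1_def a2_def])
      show "\<And>j. 1 \<le> j \<Longrightarrow> j \<le> b1 \<Longrightarrow> j \<le> b2 \<Longrightarrow> S q (u p) ! (b1 - j) = S q (v p) ! (b2 - j)"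
        by (rule common_past_nth[OF gh1'(3) gh2'(2) past, where k = 0 and C = "[]" and \<tau> = \<tau>])
          (use gh1'(1) gh2'(1) in \<open>auto simp: b1_def b2_def\<close>)
      have "S q (u p) ! a1 = hd s'" "S q (v p) ! a2 = hd t'"
        unfolding U V a1_def a2_def H1_def H2_def using ne' by (auto simp: nth_append hd_conv_nth)
      then show "S q (u p) ! a1 \<noteq> S q (v p) ! a2" using st'(3) by simp
      have "h1' \<noteq> []" "h2' \<noteq> []" using gh1'(6) gh2'(5) by auto
      then have "h1' ! 0 = x 0" "h2' ! 0 = y 0"
        using gh1'(4) gh2'(3) by (auto simp: occurs_at_def)
      then have "S q (u p) ! b1 = x 0" "S q (v p) ! b2 = y 0"
        unfolding gh1'(1) gh2'(1) b1_def b2_def by (auto simp: nth_append)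
      then show "S q (u p) ! b1 \<noteq> S q (v p) ! b2" using neq by simp
      have bu: "E * maxlen q + 2 * ((n + 1) * maxlen q) \<le> length (S q (take M (u p)))"
        and bv: "E * maxlen q + 2 * ((n + 1) * maxlen q) \<le> length (S q (take M (v p)))"
        using big[of "u p" q] big[of "v p" q] u(2) v(2) by (simp_all add: D_def algebra_simps)
      have a1: "length (S q (take M (u p))) \<le> a1" "a1 \<le> length (S q (take M (u p))) + (n + 1) * maxlen q"
        using gh1(6)[of k] gh1(7)[of k] lC unfolding kp a1_def by simp_all
      have a2: "length (S q (take M (v p))) \<le> a2" "a2 \<le> length (S q (take M (v p))) + (n + 1) * maxlen q"
        using gh2(6)[of k] gh2(7)[of k] lC unfolding kp a2_def by simp_all
      have b1: "length (S q (take M (u p))) \<le> b1" "b1 \<le> length (S q (take M (u p))) + (n + 1) * maxlen q"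
        using gh1'(7)[of 0] gh1'(8)[of 0] unfolding b1_def by simp_all
      have b2: "length (S q (take M (v p))) \<le> b2" "b2 \<le> length (S q (take M (v p))) + (n + 1) * maxlen q"
        using gh2'(6)[of 0] gh2'(7)[of 0] unfolding b2_def by simp_all
      show "E * maxlen q + 2 * ((n + 1) * maxlen q) \<le> a1"
        "E * maxlen q + 2 * ((n + 1) * maxlen q) \<le> a2"
        "E * maxlen q + 2 * ((n + 1) * maxlen q) \<le> b1"
        "E * maxlen q + 2 * ((n + 1) * maxlen q) \<le> b2"
        using bu bv a1(1) a2(1) b1(1) b2(1) by linarith+
      show "a1 \<le> b1 + (n + 1) * maxlen q"
        "b1 \<le> a1 + (n + 1) * maxlen q"
        "a2 \<le> b2 + (n + 1) * maxlen q"
        "b2 \<le> a2 + (n + 1) * maxlen q"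
        using a1 a2 b1 b2 by linarith+
      show "a2 \<le> length (S q (v p))"
        unfolding V a2_def by simp
      show "b2 \<le> length (S q (v p))"
        unfolding gh2'(1) b2_def by simp
      show "\<exists>i<E * maxlen q. S q (v p) ! (i0 + i) \<noteq> S q (v p) ! (i0 + i + e)"
        if e: "0 < e" "e \<le> 2 * ((n + 1) * maxlen q)" "i0 + E * maxlen q + e \<le> length (S q (v p))" for i0 e
      proof -
        have "drop i0 (S q (v p)) \<in> lang \<tau>"
          using lang_sublist[OF lang_substw_pow[OF v(1)]] sublist_drop by blast
        moreover have "e \<le> D * maxlen q" using e(2) by (simp add: D_def algebra_simps)
        moreover have "E * maxlen q + e \<le> length (drop i0 (S q (v p)))" using e(3) by simp
        ultimately obtain i where "i < E * maxlen q" "drop i0 (S q (v p)) ! i \<noteq> drop i0 (S q (v p)) ! (i + e)"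
          using E[OF _ e(1) _ order_refl] by blast
        then show ?thesis using e(3) by (intro exI[of _ i]) (simp add: add.assoc)
      qed
    qed
    then have cut: "a1 = b1" "a2 = b2" by simp_all
    \<comment> \<open>Equal cuts leave equal words on the right, so the end vertex of the walk is
      read off in \<open>x\<close> and \<open>y\<close> at index 0.\<close>
    have "h1' = H1" "h2' = H2"
      using U gh1'(1) V gh2'(1) cut unfolding a1_def a2_def b1_def b2_def
      by (metis append_assoc append_eq_append_conv length_append)+
    then have "occurs_at x 0 s'" "occurs_at y 0 t'"
      using gh1'(4) gh2'(3) by (simp_all add: H1_def H2_def occurs_at_append)
    then have ss: "s' = s" "t' = t"
      using occurs_at_unique occ_s st' ls by metis+
    have fixed: "(ls_next \<tau> ^^ k) (s, t) = (s, t)"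
      using ss unfolding s'_def t'_def by (metis prod.collapse)
    \<comment> \<open>The word begins at \<open>- int b1\<close>, which equals
      \<open>- int a1\<close>; this fixes where the image of \<open>s\<close> and its neighbours
      lies in \<open>x\<close>.\<close>
    have "occurs_at x (- int a1) (S q (u p))"
      using u(3)[of q] gh1'(2) cut unfolding uq b1_def by simp
    moreover have "S q (u p) = S k (butlast g1) @ S k ([x (-1)] @ s @ [x (int n)]) @ S k (drop (Suc n) h1)"
    proof -
      have nh: "n < length h1" using gh1(5) Mn by simp
      then have "drop n h1 = h1 ! n # drop (Suc n) h1" by (simp add: Cons_nth_drop_Suc)
      moreover have "h1 ! n = x (int n)" using gh1(3) nh by (simp add: occurs_at_def)
      ultimately have "h1 = s @ [x (int n)] @ drop (Suc n) h1" using hs(1) by simp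
      then have "S p (u p) = butlast g1 @ ([x (-1)] @ s @ [x (int n)]) @ drop (Suc n) h1"
        using g1 gh1(1) by (metis append_assoc)
      then show ?thesis using kp substw_pow_add[of k p \<tau> "u p"] by (metis substw_pow_append)
    qed
    ultimately have "occurs_at x (- int a1 + int (length (S k (butlast g1)))) (S k ([x (-1)] @ s @ [x (int n)]))"
      by (simp only: occurs_at_append)
    moreover have "- int a1 + int (length (S k (butlast g1))) = - int (length (S k [x (-1)])) - int (length C)"
    proof -
      have "S k g1 = S k (butlast g1) @ S k [x (-1)]" using g1 by (metis substw_pow_append)
      then show ?thesis by (simp add: a1_def)
    qed
    ultimately have "occurs_at x (- int (length (S k [x (-1)])) - int (length C)) (S k ([x (-1)] @ s @ [x (int n)]))"
      by simp
    then show ?thesis using k1 fixed CW ss unfolding k_def[symmetric] by blast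
  qed
  then have "(\<lambda>q. q - p) ` {q. p < q \<and> (u q, v q) = (u p, v p)} \<subseteq> ?G" by blast
  moreover have "inj_on (\<lambda>q. q - p) {q. p < q \<and> (u q, v q) = (u p, v p)}"
    by (auto simp: inj_on_def)
  ultimately show "infinite ?G" using p by (meson finite_imageD finite_subset)
qed

end

section \<open>Generators and the growth of their completions\<close>

definition left_part :: "('a \<Rightarrow> 'a list) \<Rightarrow> 'a list \<Rightarrow> nat \<Rightarrow> 'a list" where
  "left_part \<tau> v k = concat (map (\<lambda>i. (substw \<tau> ^^ i) v) (rev [0..<k]))"

definition right_part :: "('a \<Rightarrow> 'a list) \<Rightarrow> 'a list \<Rightarrow> nat \<Rightarrow> 'a list" where
  "right_part \<tau> w k = concat (map (\<lambda>i. (substw \<tau> ^^ i) w) [0..<k])"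

text \<open>Here \<open>P\<close> is the index in \<open>x\<close> of the first letter of
  \<open>u\<close>. Every iterate of \<open>u\<close> is placed so that its central copy of
  \<open>u\<close> stands there; together the iterates exhaust the completion. This form is easy to
  reverse and can be tested on infinitely many \<open>k\<close>.\<close>

definition generated_at ::
    "('a \<Rightarrow> 'a list) \<Rightarrow> (int \<Rightarrow> 'a) \<Rightarrow> 'a list \<Rightarrow> 'a list \<Rightarrow> 'a list \<Rightarrow> int \<Rightarrow> bool" where
  "generated_at \<tau> x v u w P \<longleftrightarrow> generator \<tau> v u w \<and>
    (\<forall>k. occurs_at x (P - int (length (left_part \<tau> v k))) ((substw \<tau> ^^ k) u))"

lemma left_part_Nil [simp]: "left_part \<tau> [] k = []"
  by (auto simp: left_part_def)

lemma right_part_Nil [simp]: "right_part \<tau> [] k = []"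
  by (auto simp: right_part_def)

text \<open>Applying the \<open>k\<close>-th iterate to \<open>v @ u @ w\<close> puts new blocks at
  the outer ends of the word already built. It is also used with \<open>v\<close> or
  \<open>w\<close> empty, where that side does not grow.\<close>

lemma substw_pow_generator:
  assumes "substw \<tau> u = v @ u @ w"
  shows "(substw \<tau> ^^ k) u = left_part \<tau> v k @ u @ right_part \<tau> w k"
proof (induction k)
  case 0
  then show ?case by (simp add: left_part_def right_part_def)
next
  case (Suc k)
  have "(substw \<tau> ^^ Suc k) u = (substw \<tau> ^^ k) (v @ u @ w)"
    using assms by (simp add: funpow_Suc_right del: funpow.simps)
  also have "\<dots> = (substw \<tau> ^^ k) v @ (substw \<tau> ^^ k) u @ (substw \<tau> ^^ k) w"
    by (simp add: substw_pow_append)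
  finally show ?case using Suc by (simp add: left_part_def right_part_def)
qed

lemma left_part_le:
  assumes "k \<le> k'"
  obtains e where "left_part \<tau> v k' = e @ left_part \<tau> v k"
proof -
  have "[0..<k'] = [0..<k] @ [k..<k']" using assms upt_add_eq_append[of 0 k "k' - k"] by simp
  then show ?thesis using that by (simp add: left_part_def)
qed

lemma right_part_le:
  assumes "k \<le> k'"
  obtains e where "right_part \<tau> w k' = right_part \<tau> w k @ e"
proof -
  have "[0..<k'] = [0..<k] @ [k..<k']" using assms upt_add_eq_append[of 0 k "k' - k"] by simp
  then show ?thesis using that by (simp add: right_part_def)
qed

lemma hd_substw_pow:
  assumes "is_substitution \<tau>"
  shows "hd ((substw \<tau> ^^ k) [b]) = (ll_next \<tau> ^^ k) b \<and> (substw \<tau> ^^ k) [b] \<noteq> []"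
proof (induction k)
  case (Suc k)
  obtain a r where r: "(substw \<tau> ^^ k) [b] = a # r" using Suc by (meson neq_Nil_conv)
  have "\<tau> a \<noteq> []" using assms by (simp add: is_substitution_def)
  moreover have "substw \<tau> (a # r) = \<tau> a @ substw \<tau> r" by (simp add: substw_def)
  moreover have "(ll_next \<tau> ^^ k) b = a" using Suc r by simp
  ultimately show ?case using r by (simp add: ll_next_def[of \<tau> a])
qed simp

lemma last_substw_pow:
  assumes "is_substitution \<tau>"
  shows "last ((substw \<tau> ^^ k) [b]) = (rl_next \<tau> ^^ k) b \<and> (substw \<tau> ^^ k) [b] \<noteq> []"
proof (induction k)
  case (Suc k)
  then obtain a r where r: "(substw \<tau> ^^ k) [b] = r @ [a]" by (meson rev_exhaust)
  have "\<tau> a \<noteq> []" using assms by (simp add: is_substitution_def)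
  moreover have "substw \<tau> (r @ [a]) = substw \<tau> r @ \<tau> a" by (simp add: substw_def)
  moreover have "(rl_next \<tau> ^^ k) b = a" using Suc r by simp
  ultimately show ?case using r by (simp add: rl_next_def[of \<tau> a])
qed simp

context primitive_substitution
begin

text \<open>A letter equal to its own image never produces another letter, so primitivity leaves it
  as the only letter, and then no iterate grows. This makes the new outer block nonempty when a
  letter is adjoined to \<open>s\<close>.\<close>

lemma no_fixed_letter: "substw \<tau> [b] \<noteq> [b]"
proof
  assume *: "substw \<tau> [b] = [b]"
  have pow: "S j [b] = [b]" for j by (induction j) (simp_all add: *)
  obtain m where "\<And>a c. sublist [c] (S m [a])" using is_primitive unfolding primitive_def by blast
  then have "sublist [c] [b]" for c using pow by metis
  then have all: "c = b" for c using set_mono_sublist by fastforce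
  obtain a where a: "\<forall>N. \<exists>m. length (S m [a]) > N" using is_primitive unfolding primitive_def by blast
  then obtain m where "length (S m [a]) > 1" by blast
  then show False using all[of a] pow by simp
qed

lemma length_right_part:
  assumes "w \<noteq> []" shows "k \<le> length (right_part \<tau> w k)"
proof (induction k)
  case (Suc k)
  have "S k w \<noteq> []" using assms by simp
  then have "1 \<le> length (S k w)" by (cases "S k w") auto
  then show ?case using Suc by (simp add: right_part_def)
qed simp

lemma length_left_part:
  assumes "w \<noteq> []" shows "k \<le> length (left_part \<tau> w k)"
proof (induction k)
  case (Suc k)
  have "S k w \<noteq> []" using assms by simp
  then have "1 \<le> length (S k w)" by (cases "S k w") auto
  then show ?case using Suc by (simp add: left_part_def)
qed simp

text \<open>Index 0 of the completion carries the first letter of \<open>w\<close>, which stands at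
  \<open>P + int (length u)\<close> in \<open>x\<close>; this is the shift.\<close>

lemma generated_at_orbit_eq:
  assumes "generated_at \<tau> x v u w P"
  shows "orbit_eq (completion \<tau> v u w) x"
proof -
  have g: "v \<noteq> []" "u \<noteq> []" "w \<noteq> []" "substw \<tau> u = v @ u @ w"
    using assms by (auto simp: generated_at_def generator_def)
  have occ: "occurs_at x (P - int (length (left_part \<tau> v k))) (left_part \<tau> v k @ u @ right_part \<tau> w k)" for k
    using assms substw_pow_generator[OF g(4)] by (simp add: generated_at_def)
  have occL: "occurs_at x (P - int (length (left_part \<tau> v k))) (left_part \<tau> v k @ u)"
    and occR: "occurs_at x (P + int (length u)) (right_part \<tau> w k)" for k
    using occ[of k] by (simp_all add: occurs_at_append)
  have "completion \<tau> v u w i = x (i + (P + int (length u)))" for i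
  proof (cases "i \<ge> 0")
    case True
    define n where "n = nat i"
    have "right_inf \<tau> w n = right_part \<tau> w (Suc n) ! n" by (simp add: right_inf_def right_part_def)
    also have "\<dots> = x (P + int (length u) + int n)"
      using occR[of "Suc n"] length_right_part[OF g(3), of "Suc n"] by (simp add: occurs_at_def)
    finally show ?thesis using True by (simp add: completion_def n_def algebra_simps)
  next
    case False
    define n where "n = nat (- i - 1)"
    \<comment> \<open>\<open>Suc n\<close> nonempty blocks have at least \<open>Suc n\<close>
      letters, so position \<open>n\<close> lies inside them.\<close>
    let ?Z = "left_part \<tau> v (Suc n) @ u"
    have rL: "concat (map (\<lambda>k. rev (S k v)) [0..<Suc n]) = rev (left_part \<tau> v (Suc n))"
      unfolding left_part_def by (simp only: rev_concat rev_map rev_rev_ident map_map o_def)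
    have len: "n < length ?Z" using length_left_part[OF g(1), of "Suc n"] by simp
    have "left_inf \<tau> v u n = rev ?Z ! n" unfolding left_inf_def rL by simp
    also have "\<dots> = ?Z ! (length ?Z - Suc n)" by (rule rev_nth[OF len])
    also have "\<dots> = x (P - int (length (left_part \<tau> v (Suc n))) + int (length ?Z - Suc n))"
      using occL[of "Suc n"] len unfolding occurs_at_def by auto
    also have "P - int (length (left_part \<tau> v (Suc n))) + int (length ?Z - Suc n) = i + (P + int (length u))"
    proof -
      have "int (length ?Z - Suc n) = int (length ?Z) - int (Suc n)" using len by (intro of_nat_diff) simp
      then show ?thesis using False by (simp add: n_def)
    qed
    finally show ?thesis using False by (simp add: completion_def n_def)
  qed
  then show ?thesis unfolding orbit_eq_def by blast
qed

text \<open>The occurrence of a late iterate contains the earlier ones at the right places, so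
  infinitely many \<open>k\<close> suffice. The case \<open>k = 0\<close> then puts \<open>u\<close>
  into the language.\<close>

lemma generated_atI:
  assumes x: "x \<in> shift_space \<tau>" and ne: "v \<noteq> []" "u \<noteq> []" "w \<noteq> []"
    and u: "substw \<tau> u = v @ u @ w" and G: "infinite G"
    and occ: "\<And>k. k \<in> G \<Longrightarrow> occurs_at x (P - int (length (left_part \<tau> v k))) (S k u)"
  shows "generated_at \<tau> x v u w P"
proof -
  have occ': "occurs_at x (P - int (length (left_part \<tau> v k))) (S k u)" for k
  proof -
    obtain k' where k': "k' \<in> G" "k < k'" using G by (meson finite_nat_set_iff_bounded_le not_le)
    obtain e where e: "left_part \<tau> v k' = e @ left_part \<tau> v k"
      using left_part_le[of k k'] k'(2) by (metis less_imp_le)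
    obtain f where f: "right_part \<tau> w k' = right_part \<tau> w k @ f"
      using right_part_le[of k k'] k'(2) by (metis less_imp_le)
    have "S k' u = e @ S k u @ f"
      using substw_pow_generator[OF u, of k'] substw_pow_generator[OF u, of k] e f by simp
    then have "occurs_at x (P - int (length (left_part \<tau> v k')) + int (length e)) (S k u)"
      using occ[OF k'(1)] by (simp add: occurs_at_append)
    then show ?thesis using e by simp
  qed
  have "occurs_at x P u" using occ'[of 0] by (simp add: left_part_def)
  then have "u \<in> lang \<tau>" using occurs_at_lang x ne(2) by blast
  then show ?thesis using occ' ne u by (simp add: generated_at_def generator_def)
qed

lemma right_special_generated:
  assumes inf: "infinite (shift_space \<tau>)" and seg: "\<exists>k. left_segregating \<tau> k"
    and ll: "subfixed_on UNIV (ll_next \<tau>)" and rl: "subfixed_on UNIV (rl_next \<tau>)"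
    and ls: "subfixed_on (ls_vertices \<tau>) (ls_next \<tau>)"
    and rs: "right_special \<tau> x"
  shows "\<exists>v u w P. generated_at \<tau> x v u w P"
proof -
  obtain y where x: "x \<in> shift_space \<tau>" and y: "y \<in> shift_space \<tau>" and neq: "x 0 \<noteq> y 0"
    and past: "\<And>i. i \<le> -1 \<Longrightarrow> x i = y i" using rs unfolding right_special_def by blast
  define n where "n = (LEAST k. left_segregating \<tau> k)"
  define s where "s = map (\<lambda>j. x (int j)) [0..<n]"
  define t where "t = map (\<lambda>j. y (int j)) [0..<n]"
  define b c where "b = x (-1)" and "c = x (int n)"
  define G where "G = {k. k \<ge> 1 \<and> (ls_next \<tau> ^^ k) (s, t) = (s, t) \<and>
      (\<exists>C W W'. S k s = C @ s @ W \<and> S k t = C @ t @ W' \<and>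
        occurs_at x (- int (length (S k [b])) - int (length C)) (S k ([b] @ s @ [c])))}"
  note self = right_special_self_similar[OF inf seg x y neq past n_def s_def t_def]
  have vert: "(s, t) \<in> ls_vertices \<tau>" by (rule self(1))
  have G: "infinite G" using self(2) unfolding G_def b_def c_def .
  then obtain k0 where k0: "k0 \<in> G" by (metis ex_in_conv finite.emptyI)
  have fixed: "ls_next \<tau> (s, t) = (s, t)"
    using k0 funpow_subfixed_return[OF ls vert, of k0] unfolding G_def by simp
  obtain d w w' where d: "substw \<tau> s = d @ s @ w" "substw \<tau> t = d @ t @ w'"
    using ls_next_step[OF seg vert] unfolding fixed fst_conv snd_conv by metis
  have st: "length s = n" "length t = n" "hd s \<noteq> hd t"
    using vert unfolding ls_vertices_def Let_def n_def[symmetric] by (auto simp: lang_k_def)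
  have "left_segregating \<tau> n" unfolding n_def using seg by (rule LeastI_ex)
  then have ne: "s \<noteq> []" "t \<noteq> []" using st by (auto simp: left_segregating_def)
  have occ: "occurs_at x (- int (length (S k [b])) - int (length (left_part \<tau> d k))) (S k ([b] @ s @ [c]))"
    if k: "k \<in> G" for k
  proof -
    obtain C W W' where C: "S k s = C @ s @ W" "S k t = C @ t @ W'"
      "occurs_at x (- int (length (S k [b])) - int (length C)) (S k ([b] @ s @ [c]))"
      using k unfolding G_def by blast
    \<comment> \<open>Both words stop at the first difference of \<open>S k s\<close> and
      \<open>S k t\<close>.\<close>
    have "C = left_part \<tau> d k"
    proof (rule first_difference_unique)
      show "C @ s @ W = left_part \<tau> d k @ s @ right_part \<tau> w k"
        using C(1) substw_pow_generator[OF d(1)] by simp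
      show "C @ t @ W' = left_part \<tau> d k @ t @ right_part \<tau> w' k"
        using C(2) substw_pow_generator[OF d(2)] by simp
    qed (use ne st in auto)
    then show ?thesis using C(3) by simp
  qed
  \<comment> \<open>The left side is settled first, while \<open>w\<close> may still be empty. The
    equation for \<open>P\<close> says that \<open>c\<close> stands directly to the right of
    \<open>u\<close>.\<close>
  have "\<exists>v u P. v \<noteq> [] \<and> u \<noteq> [] \<and> substw \<tau> u = v @ u @ w \<and> P + int (length u) = int n \<and>
    (\<forall>k\<in>G. occurs_at x (P - int (length (left_part \<tau> v k))) (S k (u @ [c])))"
  proof (cases "d = []")
    case False
    have "occurs_at x (0 - int (length (left_part \<tau> d k))) (S k (s @ [c]))" if "k \<in> G" for k
      using occ[OF that] substw_pow_append[of k \<tau> "[b]" "s @ [c]"] by (simp add: occurs_at_append)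
    then show ?thesis using False d(1) ne(1) st(1) by (intro exI[of _ d] exI[of _ s] exI[of _ 0]) simp
  next
    case True
    have occ': "occurs_at x (- int (length (S k [b]))) (S k ([b] @ s @ [c]))" if "k \<in> G" for k
      using occ[OF that] True by simp
    \<comment> \<open>With \<open>d\<close> empty the image of \<open>b\<close> ends at index -1,
      where \<open>x\<close> has \<open>b\<close> again; so \<open>b\<close> lies on a cycle of the
      rl graph.\<close>
    have "occurs_at x (- int (length (S k0 [b]))) (S k0 [b])"
      using occ'[OF k0] by (simp only: substw_pow_append occurs_at_append)
    moreover have neb: "S k0 [b] \<noteq> []" by simp
    ultimately have "last (S k0 [b]) = b"
      by (simp add: occurs_at_def last_conv_nth Suc_leI b_def del: S_eq_Nil)
    then have "(rl_next \<tau> ^^ k0) b = b" using last_substw_pow[OF is_substitution, of k0 b] by simp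
    then have "rl_next \<tau> b = b" using funpow_subfixed_return[OF rl, of b k0] k0 by (simp add: G_def)
    then have bb: "substw \<tau> [b] = butlast (\<tau> b) @ [b]"
      using is_substitution unfolding is_substitution_def rl_next_def substw_def
      by (simp, metis append_butlast_last_id)
    define v where "v = butlast (\<tau> b)"
    have vb: "substw \<tau> [b] = v @ [b] @ []" using bb by (simp add: v_def)
    have "v \<noteq> []" using vb no_fixed_letter[of b] by auto
    moreover have "substw \<tau> ([b] @ s) = v @ ([b] @ s) @ w"
      using vb d(1) True by (simp add: substw_def)
    \<comment> \<open>The new word starts with \<open>b\<close>, one place before \<open>s\<close>,
      hence \<open>P = -1\<close>.\<close>
    moreover have "occurs_at x (-1 - int (length (left_part \<tau> v k))) (S k (([b] @ s) @ [c]))"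
      if "k \<in> G" for k
    proof -
      have "- int (length (S k [b])) = -1 - int (length (left_part \<tau> v k))"
        using substw_pow_generator[OF vb, of k] by simp
      then show ?thesis using occ'[OF that] by simp
    qed
    ultimately show ?thesis using st(1) by (intro exI[of _ v] exI[of _ "[b] @ s"] exI[of _ "-1"]) simp
  qed
  then obtain v u P where v: "v \<noteq> []" "u \<noteq> []" "substw \<tau> u = v @ u @ w" "P + int (length u) = int n"
    and occu: "\<And>k. k \<in> G \<Longrightarrow> occurs_at x (P - int (length (left_part \<tau> v k))) (S k (u @ [c]))"
    by blast
  show ?thesis
  proof (cases "w = []")
    case False
    have "occurs_at x (P - int (length (left_part \<tau> v k))) (S k u)" if "k \<in> G" for k
      using occu[OF that] by (simp add: substw_pow_append occurs_at_append)
    then show ?thesis using generated_atI[OF x v(1,2) False v(3) G] by blast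
  next
    case True
    \<comment> \<open>With \<open>w\<close> empty nothing grows to the right of \<open>u\<close>, so
      the image of \<open>c\<close> starts at index \<open>n\<close>, where \<open>x\<close> has
      \<open>c\<close>; so \<open>c\<close> lies on a cycle of the ll graph.\<close>
    have "S k0 (u @ [c]) = (left_part \<tau> v k0 @ u) @ S k0 [c]"
      using substw_pow_generator[OF v(3), of k0] True by (simp add: substw_pow_append)
    then have "occurs_at x (P - int (length (left_part \<tau> v k0)) + int (length (left_part \<tau> v k0 @ u))) (S k0 [c])"
      using occu[OF k0] by (simp only: occurs_at_append)
    then have "occurs_at x (int n) (S k0 [c])" using v(4) by simp
    moreover have "S k0 [c] \<noteq> []" by simp
    ultimately have "hd (S k0 [c]) = c"
      by (simp add: occurs_at_def hd_conv_nth c_def del: S_eq_Nil)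
    then have "(ll_next \<tau> ^^ k0) c = c" using hd_substw_pow[OF is_substitution, of k0 c] by simp
    then have "ll_next \<tau> c = c" using funpow_subfixed_return[OF ll, of c k0] k0 by (simp add: G_def)
    moreover have "\<tau> c \<noteq> []" using is_substitution by (simp add: is_substitution_def)
    ultimately have c: "\<tau> c = c # tl (\<tau> c)" by (metis ll_next_def list.collapse)
    have "tl (\<tau> c) \<noteq> []"
      using c no_fixed_letter[of c] by (auto simp: substw_def)
    moreover have "substw \<tau> (u @ [c]) = v @ (u @ [c]) @ tl (\<tau> c)"
    proof -
      have "substw \<tau> (u @ [c]) = substw \<tau> u @ \<tau> c" by (simp add: substw_def)
      then show ?thesis using v(3) True c by simp
    qed
    moreover have "u @ [c] \<noteq> []" by simp
    ultimately show ?thesis using generated_atI[OF x v(1) _ _ _ G] occu by blast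
  qed
qed

end

section \<open>Reversal of words and sequences\<close>

definition rev_subst :: "('a \<Rightarrow> 'a list) \<Rightarrow> 'a \<Rightarrow> 'a list" where
  "rev_subst \<tau> a = rev (\<tau> a)"

text \<open>This reflection exchanges the indices -1 and 0, the places where left and right special
  sequences branch.\<close>

definition rev_seq :: "(int \<Rightarrow> 'a) \<Rightarrow> int \<Rightarrow> 'a" where
  "rev_seq x i = x (- 1 - i)"

lemma substw_rev_subst: "substw (rev_subst \<tau>) u = rev (substw \<tau> (rev u))"
  by (induction u) (simp_all add: substw_def rev_subst_def)

lemma substw_pow_rev_subst: "(substw (rev_subst \<tau>) ^^ k) u = rev ((substw \<tau> ^^ k) (rev u))"
  by (induction k) (simp_all add: substw_rev_subst)

lemma lang_rev_subst: "u \<in> lang (rev_subst \<tau>) \<longleftrightarrow> rev u \<in> lang \<tau>"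
  unfolding lang_def by (simp add: substw_pow_rev_subst sublist_rev_right)

lemma lang_k_rev_subst: "lang_k (rev_subst \<tau>) k = rev ` lang_k \<tau> k"
proof
  show "lang_k (rev_subst \<tau>) k \<subseteq> rev ` lang_k \<tau> k"
  proof
    fix u assume "u \<in> lang_k (rev_subst \<tau>) k"
    then have "rev u \<in> lang_k \<tau> k" by (simp add: lang_k_def lang_rev_subst)
    then show "u \<in> rev ` lang_k \<tau> k" by (metis imageI rev_rev_ident)
  qed
qed (auto simp: lang_k_def lang_rev_subst)

lemma primitive_rev_subst: "primitive \<tau> \<Longrightarrow> primitive (rev_subst \<tau>)"
  unfolding primitive_def by (simp add: substw_pow_rev_subst sublist_rev_right)

lemma rev_seq_rev_seq [simp]: "rev_seq (rev_seq x) = x"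
  by (auto simp: rev_seq_def)

lemma occurs_at_rev_seq: "occurs_at (rev_seq x) i z \<longleftrightarrow> occurs_at x (- i - int (length z)) (rev z)"
proof -
  \<comment> \<open>Reversal is an involution, so one direction for all sequences yields the
    other.\<close>
  have imp: "occurs_at x (- i - int (length z)) (rev z)" if "occurs_at (rev_seq x) i z"
    for x :: "int \<Rightarrow> 'a" and i z
    unfolding occurs_at_def
  proof (intro allI impI)
    fix j assume j: "j < length (rev z)"
    then have "rev z ! j = z ! (length z - Suc j)" by (simp add: rev_nth)
    also have "\<dots> = rev_seq x (i + int (length z - Suc j))"
      using that j unfolding occurs_at_def by simp
    also have "\<dots> = x (- i - int (length z) + int j)"
      using j unfolding rev_seq_def by (simp add: Suc_leI algebra_simps)
    finally show "rev z ! j = x (- i - int (length z) + int j)" .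
  qed
  show ?thesis
    using imp[of x i z] imp[of "rev_seq x" "- i - int (length z)" "rev z"] by auto
qed

lemma shift_space_occurs:
  "x \<in> shift_space \<tau> \<longleftrightarrow> (\<forall>i z. z \<noteq> [] \<longrightarrow> occurs_at x i z \<longrightarrow> z \<in> lang \<tau>)"
proof
  assume "x \<in> shift_space \<tau>"
  then show "\<forall>i z. z \<noteq> [] \<longrightarrow> occurs_at x i z \<longrightarrow> z \<in> lang \<tau>" using occurs_at_lang by blast
next
  assume *: "\<forall>i z. z \<noteq> [] \<longrightarrow> occurs_at x i z \<longrightarrow> z \<in> lang \<tau>"
  have "seg x i j \<in> lang \<tau>" if "i \<le> j" for i j
  proof -
    have "seg x i j \<noteq> []" using that by (simp add: seg_def)
    then show ?thesis using * occurs_at_seg[OF that] by blast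
  qed
  then show "x \<in> shift_space \<tau>" by (simp add: shift_space_def)
qed

lemma shift_space_rev_subst: "x \<in> shift_space \<tau> \<Longrightarrow> rev_seq x \<in> shift_space (rev_subst \<tau>)"
  unfolding shift_space_occurs by (simp add: occurs_at_rev_seq lang_rev_subst)

text \<open>With this the least segregating numbers agree, and reversing words becomes an
  isomorphism from the rs graph of \<open>\<tau>\<close> to the ls graph of
  \<open>rev_subst \<tau>\<close>.\<close>

lemma left_segregating_rev_subst: "left_segregating (rev_subst \<tau>) k \<longleftrightarrow> right_segregating \<tau> k"
  unfolding left_segregating_def right_segregating_def lang_k_rev_subst
  by (simp add: substw_rev_subst hd_rev lcs_def)

lemma ls_vertices_rev_subst: "ls_vertices (rev_subst \<tau>) = map_prod rev rev ` rs_vertices \<tau>"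
  unfolding ls_vertices_def rs_vertices_def left_segregating_rev_subst Let_def lang_k_rev_subst
  by (auto simp: hd_rev image_iff)

lemma ls_next_rev_subst: "ls_next (rev_subst \<tau>) (map_prod rev rev p) = map_prod rev rev (rs_next \<tau> p)"
  unfolding ls_next_def rs_next_def left_segregating_rev_subst Let_def
  by (simp add: substw_rev_subst lcs_def)

lemma ll_next_rev_subst: "is_substitution \<tau> \<Longrightarrow> ll_next (rev_subst \<tau>) = rl_next \<tau>"
  by (auto simp: ll_next_def rl_next_def rev_subst_def hd_rev)

lemma rl_next_rev_subst: "is_substitution \<tau> \<Longrightarrow> rl_next (rev_subst \<tau>) = ll_next \<tau>"
  by (auto simp: ll_next_def rl_next_def rev_subst_def last_rev)

lemma subfixed_on_rev_subst:
  assumes "subfixed_on (rs_vertices \<tau>) (rs_next \<tau>)"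
  shows "subfixed_on (ls_vertices (rev_subst \<tau>)) (ls_next (rev_subst \<tau>))"
  using assms unfolding subfixed_on_def ls_vertices_rev_subst
  by (auto simp: ls_next_rev_subst)

lemma length_left_part_rev_subst: "length (left_part (rev_subst \<tau>) v k) = length (left_part \<tau> (rev v) k)"
  by (induction k) (simp_all add: left_part_def substw_pow_rev_subst)

lemma length_right_part_eq: "length (right_part \<tau> v k) = length (left_part \<tau> v k)"
  by (induction k) (simp_all add: left_part_def right_part_def)

text \<open>Reversal exchanges the two growing sides. The last letter of \<open>u\<close>, at
  \<open>P + int (length u) - 1\<close>, moves to \<open>- P - int (length u)\<close> and becomes
  the first letter of \<open>rev u\<close>.\<close>

lemma generated_at_rev_subst:
  assumes "generated_at (rev_subst \<tau>) (rev_seq x) v u w P"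
  shows "generated_at \<tau> x (rev w) (rev u) (rev v) (- P - int (length u))"
proof -
  have g: "v \<noteq> []" "u \<noteq> []" "w \<noteq> []" "rev u \<in> lang \<tau>" and "substw (rev_subst \<tau>) u = v @ u @ w"
    using assms by (auto simp: generated_at_def generator_def lang_rev_subst)
  then have "rev (substw \<tau> (rev u)) = v @ u @ w" by (simp add: substw_rev_subst)
  then have u: "substw \<tau> (rev u) = rev w @ rev u @ rev v"
    by (metis append_assoc rev_append rev_rev_ident)
  have "occurs_at x (- P - int (length u) - int (length (left_part \<tau> (rev w) k))) ((substw \<tau> ^^ k) (rev u))" for k
  proof -
    have "occurs_at (rev_seq x) (P - int (length (left_part \<tau> (rev v) k))) (rev ((substw \<tau> ^^ k) (rev u)))"
      using assms unfolding generated_at_def substw_pow_rev_subst length_left_part_rev_subst by blast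
    then have "occurs_at x (- (P - int (length (left_part \<tau> (rev v) k))) - int (length ((substw \<tau> ^^ k) (rev u))))
        ((substw \<tau> ^^ k) (rev u))" by (simp add: occurs_at_rev_seq)
    moreover have "length ((substw \<tau> ^^ k) (rev u)) =
        length (left_part \<tau> (rev w) k) + length u + length (left_part \<tau> (rev v) k)"
      using substw_pow_generator[OF u, of k] by (simp add: length_right_part_eq)
    ultimately show ?thesis by (simp add: algebra_simps)
  qed
  then show ?thesis using g u by (simp add: generated_at_def generator_def)
qed

theorem mainTheorem9:
  fixes \<tau> :: "'a::finite \<Rightarrow> 'a list" and x :: "int \<Rightarrow> 'a"
  assumes "is_substitution \<tau>"
    and "primitive \<tau>" and "aperiodic \<tau>" and "segregating \<tau>"
    and "subfixed_on UNIV (ll_next \<tau>)" and "subfixed_on UNIV (rl_next \<tau>)"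
    and "subfixed_on (ls_vertices \<tau>) (ls_next \<tau>)"
    and "subfixed_on (rs_vertices \<tau>) (rs_next \<tau>)"
    and "x \<in> shift_space \<tau>"
    and "left_special \<tau> x \<or> right_special \<tau> x"
  shows "\<exists>v u w. generator \<tau> v u w \<and> orbit_eq (completion \<tau> v u w) x"
proof -
  interpret primitive_substitution \<tau> using assms(1,2) by unfold_locales
  have inf: "infinite (shift_space \<tau>)" using assms(3) by (simp add: aperiodic_def)
  have "\<exists>v u w P. generated_at \<tau> x v u w P"
    using assms(10)
  proof
    assume "right_special \<tau> x"
    then show ?thesis
      using right_special_generated[OF inf] assms(4-7) by (simp add: segregating_def)
  next
    assume ls: "left_special \<tau> x"
    interpret R: primitive_substitution "rev_subst \<tau>"
      using assms(1,2) by unfold_locales (simp_all add: is_substitution_def rev_subst_def primitive_rev_subst)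
    \<comment> \<open>Infinitude passes to the reversed shift space along this injection.\<close>
    have "inj_on rev_seq (shift_space \<tau>)" by (metis inj_onI rev_seq_rev_seq)
    moreover have "rev_seq ` shift_space \<tau> \<subseteq> shift_space (rev_subst \<tau>)"
      using shift_space_rev_subst by blast
    ultimately have infR: "infinite (shift_space (rev_subst \<tau>))"
      using inf by (meson finite_imageD finite_subset)
    obtain y where y: "y \<in> shift_space \<tau>" "x (-1) \<noteq> y (-1)" "\<forall>i\<ge>0. x i = y i"
      using ls by (auto simp: left_special_def)
    have "right_special (rev_subst \<tau>) (rev_seq x)"
      unfolding right_special_def
    proof (intro conjI bexI[of _ "rev_seq y"])
      show "\<forall>i\<le>-1. rev_seq x i = rev_seq y i" using y(3) by (simp add: rev_seq_def)
    qed (use y shift_space_rev_subst assms(9) in \<open>auto simp: rev_seq_def\<close>)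
    then have "\<exists>v u w P. generated_at (rev_subst \<tau>) (rev_seq x) v u w P"
      using R.right_special_generated[OF infR] assms(1,4,5,6) subfixed_on_rev_subst[OF assms(8)]
      by (simp add: segregating_def left_segregating_rev_subst ll_next_rev_subst rl_next_rev_subst)
    then show ?thesis using generated_at_rev_subst by blast
  qed
  then obtain v u w P where g: "generated_at \<tau> x v u w P" by blast
  then have "generator \<tau> v u w" by (simp add: generated_at_def)
  then show ?thesis using generated_at_orbit_eq[OF g] by blast
qed

end
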